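(* Let $L_{B(\ell_2)}$ be the operator $\sum_{m,k}a_{m,k}e_{m,k}\mapsto\sum_{m,k}|m-k|^2a_{m,k}e_{m,k}$ on matrices, with semigroup $\mathcal S=(S_t)_{t\ge0}$, $S_t=e^{-tL_{B(\ell_2)}}$. There exists a constant $C>0$ independent of $t\in\mathbb R$ such that for all $A\in\mathcal A_{B(\ell_2)}$ $$\big\|(\mathrm{id}_{B(\ell_2)}+L_{B(\ell_2)})^{-s}e^{itL_{B(\ell_2)}}A\big\|_{BMO^c_{\mathcal S}(B(\ell_2))}\le C(1+|t|)^{1/2}\|A\|_{B(\ell_2)}\quad\text{for } s\ge\tfrac12.$$ Furthermore, for any $1<p<\infty$ there exists a constant $C_p>0$ independent of $t\in\mathbb R$ such that for all $A\in\mathcal A_{B(\ell_2)}$ $$\big\|(\mathrm{id}_{B(\ell_2)}+L_{B(\ell_2)})^{-s}e^{itL_{B(\ell_2)}}A\big\|_{S_p}\le C_p(1+|t|)^{|1/2-1/p|}\|A\|_{S_p}\quad\text{for } s\ge\Big|\tfrac12-\tfrac1p\Big|.$$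
   Context: $e_{m,k}$ are the standard matrix units of $B(\ell_2)$ (indices integers), $S_p=L_p(B(\ell_2))$ is the Schatten $p$-class on $\ell_2$. $\mathcal A_{B(\ell_2)}$ is the algebra of matrices $A=\sum_{m\in I,k\in J}a_{m,k}e_{m,k}$ with $I,J$ finite. The Markov semigroup is $S_t(\sum a_{m,k}e_{m,k})=\sum e^{-t|m-k|^2}a_{m,k}e_{m,k}$, and for a function $F$, $F(L_{B(\ell_2)})$ is the Schur multiplier $\sum a_{m,k}e_{m,k}\mapsto\sum F(|m-k|^2)a_{m,k}e_{m,k}$; thus the operator considered multiplies the $(m,k)$ entry by $(1+|m-k|^2)^{-s}e^{it|m-k|^2}$. The column BMO norm is $\|A\|_{BMO^c_{\mathcal S}(B(\ell_2))}=\sup_{t>0}\|S_t(|(I-S_t)A|^2)\|_{B(\ell_2)}^{1/2}$ with $|x|^2=x^*x$. *)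

theory Defs
  imports "HOL-Analysis.Analysis"
begin

text \<open>
  Operators on $\ell_2$ over the integers are given by their matrices
  \<^term>\<open>A :: int \<Rightarrow> int \<Rightarrow> complex\<close>, with entry \<^term>\<open>A m k\<close> in row m and column k.
\<close>

type_synonym cvec = "int \<Rightarrow> complex"
type_synonym cmatrix = "int \<Rightarrow> int \<Rightarrow> complex"

definition ell2 :: "cvec set" where
  "ell2 = {x. (\<lambda>i. (cmod (x i))\<^sup>2) summable_on UNIV}"

definition ell2_norm :: "cvec \<Rightarrow> real" where
  "ell2_norm x = sqrt (\<Sum>\<^sub>\<infinity>i. (cmod (x i))\<^sup>2)"

definition ell2_inner :: "cvec \<Rightarrow> cvec \<Rightarrow> complex" where
  "ell2_inner x y = (\<Sum>\<^sub>\<infinity>i. cnj (x i) * y i)"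

definition mat_app :: "cmatrix \<Rightarrow> cvec \<Rightarrow> cvec" where
  "mat_app A x = (\<lambda>m. \<Sum>\<^sub>\<infinity>k. A m k * x k)"

definition mat_mult :: "cmatrix \<Rightarrow> cmatrix \<Rightarrow> cmatrix" where
  "mat_mult A B = (\<lambda>m k. \<Sum>\<^sub>\<infinity>j. A m j * B j k)"

definition mat_adj :: "cmatrix \<Rightarrow> cmatrix" where
  "mat_adj A = (\<lambda>m k. cnj (A k m))"

definition mat_trace :: "cmatrix \<Rightarrow> complex" where
  "mat_trace A = (\<Sum>\<^sub>\<infinity>m. A m m)"

definition fin_matrices :: "cmatrix set" where
  "fin_matrices = {A. \<exists>I J. finite I \<and> finite J \<and> (\<forall>m k. A m k \<noteq> 0 \<longrightarrow> m \<in> I \<and> k \<in> J)}"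

definition op_norm :: "cmatrix \<Rightarrow> real" where
  "op_norm A = (SUP x\<in>{x \<in> ell2. ell2_norm x \<le> 1}. ell2_norm (mat_app A x))"

definition mat_abs_sq :: "cmatrix \<Rightarrow> cmatrix" where
  "mat_abs_sq A = mat_mult (mat_adj A) A"

text \<open>
  Real powers of a positive matrix of finite rank by functional calculus: a spectral decomposition
  $P = \sum_{i<n} l_i\, u_i u_i^*$ with $l_i > 0$ and $(u_i)$ orthonormal in $\ell_2$ gives
  $P^r = \sum_{i<n} l_i^r\, u_i u_i^*$, which does not depend on the decomposition. The kernel
  of P is not listed among the $u_i$, so that $0^r = 0$ there (this is used for $r > 0$).
\<close>

definition is_mat_powr :: "cmatrix \<Rightarrow> real \<Rightarrow> cmatrix \<Rightarrow> bool" where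
  "is_mat_powr P r Q \<longleftrightarrow>
     (\<exists>(n::nat) (l::nat \<Rightarrow> real) (u::nat \<Rightarrow> cvec).
        (\<forall>i<n. l i > 0 \<and> u i \<in> ell2) \<and>
        (\<forall>i<n. \<forall>j<n. ell2_inner (u i) (u j) = (if i = j then 1 else 0)) \<and>
        P = (\<lambda>m k. \<Sum>i<n. complex_of_real (l i) * u i m * cnj (u i k)) \<and>
        Q = (\<lambda>m k. \<Sum>i<n. complex_of_real (l i powr r) * u i m * cnj (u i k)))"

definition mat_powr :: "cmatrix \<Rightarrow> real \<Rightarrow> cmatrix" where
  "mat_powr P r = (THE Q. is_mat_powr P r Q)"

text \<open>
  The norm $(\mathrm{Tr}\,|A|^p)^{1/p}$ of $S_p$ on matrices of finite rank, where
  $|A|^p = (A^*A)^{p/2}$.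
\<close>

definition schatten_norm :: "real \<Rightarrow> cmatrix \<Rightarrow> real" where
  "schatten_norm p A = Re (mat_trace (mat_powr (mat_abs_sq A) (p / 2))) powr (1 / p)"

text \<open>
  The operator $F(L)$, where $L$ is the Schur multiplier with symbol $|m-k|^2$.
\<close>

definition fun_of_L :: "(real \<Rightarrow> complex) \<Rightarrow> cmatrix \<Rightarrow> cmatrix" where
  "fun_of_L F A = (\<lambda>m k. F ((real_of_int \<bar>m - k\<bar>)\<^sup>2) * A m k)"

definition semigroup_S :: "real \<Rightarrow> cmatrix \<Rightarrow> cmatrix" where
  "semigroup_S t = fun_of_L (\<lambda>x. complex_of_real (exp (- t * x)))"

definition bmo_col_norm :: "cmatrix \<Rightarrow> real" where
  "bmo_col_norm A =
     (SUP t\<in>{0<..}. sqrt (op_norm (semigroup_S t (mat_abs_sq (\<lambda>m k. A m k - semigroup_S t A m k)))))"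

definition bessel_L :: "real \<Rightarrow> cmatrix \<Rightarrow> cmatrix" where
  "bessel_L s = fun_of_L (\<lambda>x. complex_of_real ((1 + x) powr (- s)))"

definition schroedinger_L :: "real \<Rightarrow> cmatrix \<Rightarrow> cmatrix" where
  "schroedinger_L t = fun_of_L (\<lambda>x. exp (\<i> * complex_of_real (t * x)))"

end

theory Submission
  imports Defs "HOL-Complex_Analysis.Conformal_Mappings"
begin

text \<open>
  Only the size of the symbol $\varphi(n) = (1+n^2)^{-s} e^{itn^2}$ matters, not its oscillation.
  A Schur multiplier $(\varphi(m,k))$ has norm at most $\sup_m \|\varphi(m,\cdot)\|_{\ell_2}$ on
  $B(\ell_2)$, since $\varphi(m,k) = \langle \varphi(m,\cdot), e_k\rangle$. On the integers
  $(1+n^2)^{-1/2}$ is square summable, so for $s \ge 1/2$ the operator is bounded on $B(\ell_2)$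
  uniformly in t, and the BMO norm is at most twice the operator norm because the Gaussian
  multipliers $S_t$ are contractions. On $S_2$ the operator is a contraction for $s \ge 0$. Stein
  interpolation between the two, with $|\varphi(n)| \le (1+n^2)^{-\theta/2}$ and
  $\theta = |1 - 2/p|$, gives the bound on $S_p$.
\<close>

section \<open>Schur multipliers and the BMO estimate\<close>

text \<open>A matrix in \<open>fin_matrices\<close> lives on F x F for a finite F and Schur
  multipliers keep it there, so every norm is computed on F, with constants independent of F. The
  Schatten norm is defined by a \<open>THE\<close> over spectral decompositions. Hence singular
  value decompositions have to be constructed, and independence of the decomposition proved, before
  any S_p estimate can start. The S_p bound pairs the image B of A with its own norming matrix X, so
  that the pairing is the p-th power of the S_p norm of B. The same number is a Schur form in A and
  X, and this form is symmetric in the two matrices because the symbol acts entrywise. For p >= 2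
  the analytic family moves A towards the operator norm and X towards the trace norm; for p < 2 the
  two change places, so one interpolation lemma covers both ranges. The constant 5 bounds the sum of
  1/(1+n^2) over the integers. It enters as sqrt 5 at the operator end and as a power of sqrt 5 in
  between.\<close>

abbreviation vnorm :: "'a set \<Rightarrow> ('a \<Rightarrow> complex) \<Rightarrow> real" where
  "vnorm F x \<equiv> L2_set (\<lambda>i. cmod (x i)) F"

text \<open>For c >= 0 this says that the compression of A to F has operator norm at most c. The
  form has no conjugate on y, so that factors of a symbol can be absorbed into y and x alike;
  conjugating y does not change its norm.\<close>

definition bilin_bound :: "'a set \<Rightarrow> ('a \<Rightarrow> 'a \<Rightarrow> complex) \<Rightarrow> real \<Rightarrow> bool" where
  "bilin_bound F A c \<longleftrightarrow>
     (\<forall>x y. cmod (\<Sum>m\<in>F. \<Sum>k\<in>F. A m k * y m * x k) \<le> c * vnorm F y * vnorm F x)"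

lemma vnorm_cong: "(\<And>i. i \<in> F \<Longrightarrow> x i = y i) \<Longrightarrow> vnorm F x = vnorm F y"
  by (simp add: L2_set_def)

lemma power2_vnorm: "(vnorm F x)\<^sup>2 = (\<Sum>i\<in>F. (cmod (x i))\<^sup>2)"
  by (simp add: L2_set_def sum_nonneg)

lemma power2_vnorm_complex: "complex_of_real ((vnorm F x)\<^sup>2) = (\<Sum>i\<in>F. cnj (x i) * x i)"
  by (simp add: power2_vnorm complex_norm_square mult.commute del: of_real_power)

lemma cmod_sum_mult_le: "cmod (\<Sum>i\<in>F. x i * y i) \<le> vnorm F x * vnorm F y"
proof -
  have "cmod (\<Sum>i\<in>F. x i * y i) \<le> (\<Sum>i\<in>F. \<bar>cmod (x i)\<bar> * \<bar>cmod (y i)\<bar>)"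
    by (rule order_trans[OF norm_sum]) (simp add: norm_mult)
  also have "\<dots> \<le> vnorm F x * vnorm F y"
    by (rule L2_set_mult_ineq)
  finally show ?thesis .
qed

text \<open>Test the form with y the conjugate of A x, then cancel one factor of the norm of A
  x.\<close>

lemma bilin_bound_imp_vnorm:
  assumes "bilin_bound F A c" "c \<ge> 0"
  shows "vnorm F (\<lambda>m. \<Sum>k\<in>F. A m k * x k) \<le> c * vnorm F x"
proof -
  define z where "z = (\<lambda>m. \<Sum>k\<in>F. A m k * x k)"
  have "(\<Sum>k\<in>F. A m k * b * x k) = b * z m" for m b
    by (simp add: z_def sum_distrib_left mult_ac)
  then have "(\<Sum>m\<in>F. \<Sum>k\<in>F. A m k * cnj (z m) * x k) = (\<Sum>m\<in>F. cnj (z m) * z m)"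
    by simp
  also have "\<dots> = complex_of_real ((vnorm F z)\<^sup>2)"
    by (simp add: power2_vnorm_complex del: of_real_power)
  finally have "(vnorm F z)\<^sup>2 \<le> c * vnorm F (\<lambda>m. cnj (z m)) * vnorm F x"
    using assms(1)[unfolded bilin_bound_def, rule_format, of "\<lambda>m. cnj (z m)" x]
    by (simp add: norm_power del: of_real_power)
  then have "vnorm F z * vnorm F z \<le> c * vnorm F x * vnorm F z"
    by (simp add: power2_eq_square mult_ac)
  then have "vnorm F z \<le> c * vnorm F x"
  proof (cases "vnorm F z = 0")
    case False
    then have "vnorm F z > 0" by (simp add: order.not_eq_order_implies_strict)
    with \<open>vnorm F z * vnorm F z \<le> c * vnorm F x * vnorm F z\<close> show ?thesis
      by (rule mult_right_le_imp_le)
  qed (simp add: assms(2))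
  then show ?thesis by (simp add: z_def)
qed

lemma vnorm_imp_bilin_bound:
  assumes "\<And>x. vnorm F (\<lambda>m. \<Sum>k\<in>F. A m k * x k) \<le> c * vnorm F x"
  shows "bilin_bound F A c"
  unfolding bilin_bound_def
proof (intro allI)
  fix x y :: "'a \<Rightarrow> complex"
  have "(\<Sum>m\<in>F. \<Sum>k\<in>F. A m k * y m * x k) = (\<Sum>m\<in>F. y m * (\<Sum>k\<in>F. A m k * x k))"
    by (simp add: sum_distrib_left mult_ac)
  then have "cmod (\<Sum>m\<in>F. \<Sum>k\<in>F. A m k * y m * x k)
      \<le> vnorm F y * vnorm F (\<lambda>m. \<Sum>k\<in>F. A m k * x k)"
    using cmod_sum_mult_le[of y "\<lambda>m. \<Sum>k\<in>F. A m k * x k" F] by simp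
  also have "\<dots> \<le> vnorm F y * (c * vnorm F x)"
    by (intro mult_left_mono assms) simp
  finally show "cmod (\<Sum>m\<in>F. \<Sum>k\<in>F. A m k * y m * x k) \<le> c * vnorm F y * vnorm F x"
    by (simp add: mult_ac)
qed

lemma bilin_bound_diff:
  assumes "bilin_bound F A c" "bilin_bound F B d"
  shows "bilin_bound F (\<lambda>m k. A m k - B m k) (c + d)"
  unfolding bilin_bound_def
proof (intro allI)
  fix x y :: "'a \<Rightarrow> complex"
  have "(\<Sum>m\<in>F. \<Sum>k\<in>F. (A m k - B m k) * y m * x k) =
      (\<Sum>m\<in>F. \<Sum>k\<in>F. A m k * y m * x k) - (\<Sum>m\<in>F. \<Sum>k\<in>F. B m k * y m * x k)"
    by (simp add: algebra_simps sum_subtractf)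
  also have "cmod \<dots> \<le> c * vnorm F y * vnorm F x + d * vnorm F y * vnorm F x"
    by (rule order_trans[OF norm_triangle_ineq4])
      (use assms in \<open>auto simp: bilin_bound_def intro!: add_mono\<close>)
  finally show "cmod (\<Sum>m\<in>F. \<Sum>k\<in>F. (A m k - B m k) * y m * x k)
      \<le> (c + d) * vnorm F y * vnorm F x"
    by (simp add: algebra_simps)
qed

text \<open>Exchange the two sums: for each fixed m the squared factors add up to at most
  a^2.\<close>

lemma vnorm_factor_le:
  assumes "\<And>m. m \<in> F \<Longrightarrow> (\<Sum>j\<in>J. (cmod (\<alpha> j m))\<^sup>2) \<le> a\<^sup>2" "a \<ge> 0"
  shows "L2_set (\<lambda>j. vnorm F (\<lambda>m. \<alpha> j m * y m)) J \<le> a * vnorm F y"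
proof -
  have "(\<Sum>j\<in>J. (vnorm F (\<lambda>m. \<alpha> j m * y m))\<^sup>2)
      = (\<Sum>m\<in>F. (cmod (y m))\<^sup>2 * (\<Sum>j\<in>J. (cmod (\<alpha> j m))\<^sup>2))"
    unfolding power2_vnorm
    by (subst sum.swap) (simp add: norm_mult power_mult_distrib sum_distrib_left mult_ac)
  also have "\<dots> \<le> (\<Sum>m\<in>F. (cmod (y m))\<^sup>2 * a\<^sup>2)"
    by (intro sum_mono mult_left_mono assms) auto
  also have "\<dots> = (a * vnorm F y)\<^sup>2"
    by (simp add: power_mult_distrib power2_vnorm sum_distrib_left mult_ac)
  finally show ?thesis
    using assms(2) by (simp add: L2_set_def real_le_lsqrt sum_nonneg)
qed

text \<open>The easy half of the Grothendieck-Haagerup description of Schur multipliers. Each j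
  contributes the form of A at the vectors alpha_j y and beta_j x, and Cauchy-Schwarz over j
  recombines these contributions.\<close>

lemma bilin_bound_schur_factor:
  assumes A: "bilin_bound F A c" and c: "c \<ge> 0" and ab: "a \<ge> 0" "b \<ge> 0"
    and \<alpha>: "\<And>m. m \<in> F \<Longrightarrow> (\<Sum>j\<in>J. (cmod (\<alpha> j m))\<^sup>2) \<le> a\<^sup>2"
    and \<beta>: "\<And>k. k \<in> F \<Longrightarrow> (\<Sum>j\<in>J. (cmod (\<beta> j k))\<^sup>2) \<le> b\<^sup>2"
    and \<phi>: "\<And>m k. m \<in> F \<Longrightarrow> k \<in> F \<Longrightarrow> \<phi> m k = (\<Sum>j\<in>J. \<alpha> j m * \<beta> j k)"
  shows "bilin_bound F (\<lambda>m k. \<phi> m k * A m k) (a * b * c)"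
  unfolding bilin_bound_def
proof (intro allI)
  fix x y :: "'a \<Rightarrow> complex"
  have "(\<Sum>m\<in>F. \<Sum>k\<in>F. \<phi> m k * A m k * y m * x k)
      = (\<Sum>m\<in>F. \<Sum>k\<in>F. \<Sum>j\<in>J. A m k * (\<alpha> j m * y m) * (\<beta> j k * x k))"
    by (intro sum.cong refl) (simp add: \<phi> sum_distrib_left sum_distrib_right mult_ac)
  also have "\<dots> = (\<Sum>m\<in>F. \<Sum>j\<in>J. \<Sum>k\<in>F. A m k * (\<alpha> j m * y m) * (\<beta> j k * x k))"
    by (intro sum.cong refl sum.swap)
  also have "\<dots> = (\<Sum>j\<in>J. \<Sum>m\<in>F. \<Sum>k\<in>F. A m k * (\<alpha> j m * y m) * (\<beta> j k * x k))"
    by (rule sum.swap)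
  finally have "cmod (\<Sum>m\<in>F. \<Sum>k\<in>F. \<phi> m k * A m k * y m * x k)
      \<le> (\<Sum>j\<in>J. cmod (\<Sum>m\<in>F. \<Sum>k\<in>F. A m k * (\<alpha> j m * y m) * (\<beta> j k * x k)))"
    by (simp add: norm_sum)
  also have "\<dots> \<le> (\<Sum>j\<in>J. c * vnorm F (\<lambda>m. \<alpha> j m * y m) * vnorm F (\<lambda>k. \<beta> j k * x k))"
    using A by (intro sum_mono) (simp add: bilin_bound_def)
  also have "\<dots> = c * (\<Sum>j\<in>J. \<bar>vnorm F (\<lambda>m. \<alpha> j m * y m)\<bar> * \<bar>vnorm F (\<lambda>k. \<beta> j k * x k)\<bar>)"
    by (simp add: sum_distrib_left mult_ac)
  also have "\<dots> \<le> c * (L2_set (\<lambda>j. vnorm F (\<lambda>m. \<alpha> j m * y m)) J * L2_set (\<lambda>j. vnorm F (\<lambda>k. \<beta> j k * x k)) J)"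
    by (intro mult_left_mono L2_set_mult_ineq c)
  also have "\<dots> \<le> c * ((a * vnorm F y) * (b * vnorm F x))"
    by (intro mult_left_mono mult_mono vnorm_factor_le \<alpha> \<beta> ab c) (auto simp: ab)
  finally show "cmod (\<Sum>m\<in>F. \<Sum>k\<in>F. \<phi> m k * A m k * y m * x k) \<le> a * b * c * vnorm F y * vnorm F x"
    by (simp add: mult_ac)
qed

lemma bilin_bound_schur_rows:
  assumes A: "bilin_bound F A c" and c: "c \<ge> 0" and F: "finite F" and K: "K \<ge> 0"
    and \<phi>: "\<And>m. m \<in> F \<Longrightarrow> (\<Sum>k\<in>F. (cmod (\<phi> m k))\<^sup>2) \<le> K"
  shows "bilin_bound F (\<lambda>m k. \<phi> m k * A m k) (sqrt K * c)"
proof -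
  have "bilin_bound F (\<lambda>m k. \<phi> m k * A m k) (sqrt K * 1 * c)"
  proof (rule bilin_bound_schur_factor[OF A c, where J = F
        and \<alpha> = "\<lambda>j m. \<phi> m j" and \<beta> = "\<lambda>j k. if j = k then 1 else 0"])
    show "(\<Sum>j\<in>F. (cmod (if j = k then 1 else 0))\<^sup>2) \<le> 1\<^sup>2" if "k \<in> F" for k
    proof -
      have "(\<Sum>j\<in>F. (cmod (if j = k then 1 else 0))\<^sup>2) = (\<Sum>j\<in>F. if j = k then 1 else 0)"
        by (intro sum.cong) auto
      then show ?thesis using F by (simp add: sum.delta)
    qed
    show "\<phi> m k = (\<Sum>j\<in>F. \<phi> m j * (if j = k then 1 else 0))" if "k \<in> F" for m k
      using F that by (simp add: if_distrib[of "\<lambda>t. _ * t"] cong: if_cong)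
  qed (use K \<phi> in auto)
  then show ?thesis by simp
qed

text \<open>
  The Gaussian is a Gram kernel:
  $e^{-t(m-k)^2} = \sum_j g_j(m) g_j(k)$ with $g_j(m) = \sqrt{(2t)^j/j!}\; m^j e^{-tm^2}$.
\<close>

lemma bilin_bound_gaussian:
  fixes F :: "int set"
  assumes A: "bilin_bound F A c" and c: "c \<ge> 0" and t: "t \<ge> 0"
  shows "bilin_bound F (\<lambda>m k. complex_of_real (exp (- t * (real_of_int (m - k))\<^sup>2)) * A m k) c"
proof -
  define g :: "nat \<Rightarrow> int \<Rightarrow> real" where
    "g j m = sqrt ((2 * t) ^ j / fact j) * real_of_int m ^ j * exp (- t * (real_of_int m)\<^sup>2)" for j m
  have gg: "g j m * g j k = ((2 * t * real_of_int m * real_of_int k) ^ j /\<^sub>R fact j)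
      * (exp (- t * (real_of_int m)\<^sup>2) * exp (- t * (real_of_int k)\<^sup>2))" for j m k
  proof -
    have "sqrt ((2 * t) ^ j / fact j) * sqrt ((2 * t) ^ j / fact j) = (2 * t) ^ j / fact j"
      using t by simp
    moreover have "g j m * g j k = (sqrt ((2 * t) ^ j / fact j) * sqrt ((2 * t) ^ j / fact j))
        * (real_of_int m ^ j * real_of_int k ^ j)
        * (exp (- t * (real_of_int m)\<^sup>2) * exp (- t * (real_of_int k)\<^sup>2))"
      unfolding g_def by (simp only: mult_ac)
    ultimately show ?thesis
      by (simp only: power_mult_distrib scaleR_conv_of_real of_real_eq_id id_apply divide_inverse mult_ac)
  qed
  have sums: "(\<lambda>j. g j m * g j k) sums exp (- t * (real_of_int (m - k))\<^sup>2)" for m k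
  proof -
    have "(\<lambda>j. g j m * g j k) sums (exp (2 * t * real_of_int m * real_of_int k)
        * (exp (- t * (real_of_int m)\<^sup>2) * exp (- t * (real_of_int k)\<^sup>2)))"
      unfolding gg by (intro sums_mult2 exp_converges)
    also have "exp (2 * t * real_of_int m * real_of_int k)
        * (exp (- t * (real_of_int m)\<^sup>2) * exp (- t * (real_of_int k)\<^sup>2))
        = exp (- t * (real_of_int (m - k))\<^sup>2)"
      by (simp add: mult_exp_exp power2_eq_square algebra_simps)
    finally show ?thesis .
  qed
  \<comment> \<open>The factorisation lemma speaks of finite sums, while the Gram series is
    infinite. Its partial sums are multipliers with the same constant c, and the bound passes to the
    entrywise limit.\<close>
  define \<phi> where "\<phi> N m k = complex_of_real (\<Sum>j<N. g j m * g j k)" for N m k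
  have N: "bilin_bound F (\<lambda>m k. \<phi> N m k * A m k) c" for N
  proof -
    \<comment> \<open>On the diagonal the series is a sum of squares with total exp(0) = 1, so each
      partial sum is at most 1.\<close>
    have le: "(\<Sum>j<N. (cmod (complex_of_real (g j m)))\<^sup>2) \<le> 1\<^sup>2" for m
    proof -
      have "(\<Sum>j<N. g j m * g j m) \<le> exp (- t * (real_of_int (m - m))\<^sup>2)"
        using sum_le_suminf[of "\<lambda>j. g j m * g j m" "{..<N}"] sums[of m m]
        by (auto simp: sums_iff)
      then show ?thesis by (simp add: power2_eq_square)
    qed
    have "bilin_bound F (\<lambda>m k. \<phi> N m k * A m k) (1 * 1 * c)"
      by (rule bilin_bound_schur_factor[OF A c, where J = "{..<N}"
        and \<alpha> = "\<lambda>j m. complex_of_real (g j m)" and \<beta> = "\<lambda>j m. complex_of_real (g j m)"])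
        (use le in \<open>auto simp: \<phi>_def\<close>)
    then show ?thesis by simp
  qed
  have lim: "(\<lambda>N. \<phi> N m k) \<longlonglongrightarrow> complex_of_real (exp (- t * (real_of_int (m - k))\<^sup>2))" for m k
    unfolding \<phi>_def using sums[of m k] by (intro tendsto_of_real) (simp add: sums_def)
  show ?thesis
    unfolding bilin_bound_def
  proof (intro allI)
    fix x y :: "int \<Rightarrow> complex"
    have "(\<lambda>N. cmod (\<Sum>m\<in>F. \<Sum>k\<in>F. \<phi> N m k * A m k * y m * x k)) \<longlonglongrightarrow>
       cmod (\<Sum>m\<in>F. \<Sum>k\<in>F. complex_of_real (exp (- t * (real_of_int (m - k))\<^sup>2)) * A m k * y m * x k)"
      by (intro tendsto_intros lim)
    then show "cmod (\<Sum>m\<in>F. \<Sum>k\<in>F. complex_of_real (exp (- t * (real_of_int (m - k))\<^sup>2)) * A m k * y m * x k)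
       \<le> c * vnorm F y * vnorm F x"
      by (rule LIMSEQ_le_const2) (use N in \<open>auto simp: bilin_bound_def\<close>)
  qed
qed

section \<open>Finitely supported matrices as operators on l_2\<close>

definition supported_on :: "'a set \<Rightarrow> ('a \<Rightarrow> 'a \<Rightarrow> complex) \<Rightarrow> bool" where
  "supported_on F A \<longleftrightarrow> (\<forall>m k. A m k \<noteq> 0 \<longrightarrow> m \<in> F \<and> k \<in> F)"

text \<open>Rows and columns are put into one index set, so that A^* A is supported on the same set
  as A.\<close>

lemma fin_matrices_supported:
  assumes "A \<in> fin_matrices"
  obtains F where "finite F" "supported_on F A"
proof -
  from assms obtain I J where "finite I" "finite J" "\<forall>m k. A m k \<noteq> 0 \<longrightarrow> m \<in> I \<and> k \<in> J"
    by (auto simp: fin_matrices_def)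
  then show thesis by (intro that[of "I \<union> J"]) (auto simp: supported_on_def)
qed

lemma infsum_finite_support:
  assumes "finite F" "\<And>i. i \<notin> F \<Longrightarrow> f i = 0"
  shows "infsum f UNIV = sum f F"
proof -
  have "infsum f UNIV = infsum f F"
    by (rule infsum_cong_neutral) (use assms in auto)
  then show ?thesis using assms by simp
qed

lemma mat_app_supported:
  assumes "finite F" "supported_on F A"
  shows "mat_app A x m = (\<Sum>k\<in>F. A m k * x k)"
  unfolding mat_app_def using assms by (intro infsum_finite_support) (auto simp: supported_on_def)

lemma ell2_norm_mat_app:
  assumes "finite F" "supported_on F A"
  shows "ell2_norm (mat_app A x) = vnorm F (\<lambda>m. \<Sum>k\<in>F. A m k * x k)"
proof -
  have "mat_app A x m = 0" if "m \<notin> F" for m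
    using that assms(2) unfolding mat_app_supported[OF assms]
    by (intro sum.neutral) (auto simp: supported_on_def)
  then have "(\<Sum>\<^sub>\<infinity>i. (cmod (mat_app A x i))\<^sup>2) = (\<Sum>i\<in>F. (cmod (mat_app A x i))\<^sup>2)"
    using assms by (intro infsum_finite_support) auto
  then show ?thesis using assms by (simp add: ell2_norm_def L2_set_def mat_app_supported)
qed

lemma vnorm_le_ell2_norm:
  assumes "finite F" "x \<in> ell2"
  shows "vnorm F x \<le> ell2_norm x"
  unfolding L2_set_def ell2_norm_def
  using assms by (auto simp: ell2_def intro!: finite_sum_le_infsum)

lemma op_norm_le:
  assumes "finite F" "supported_on F A" "bilin_bound F A c" "c \<ge> 0"
  shows "op_norm A \<le> c"
  unfolding op_norm_def
proof (rule cSUP_least)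
  have "(\<lambda>i. 0) \<in> {x \<in> ell2. ell2_norm x \<le> 1}"
    by (simp add: ell2_def ell2_norm_def)
  then show "{x \<in> ell2. ell2_norm x \<le> 1} \<noteq> {}" by blast
next
  fix x assume x: "x \<in> {x \<in> ell2. ell2_norm x \<le> 1}"
  have "ell2_norm (mat_app A x) \<le> c * vnorm F x"
    using assms by (simp add: ell2_norm_mat_app bilin_bound_imp_vnorm)
  also have "\<dots> \<le> c * 1"
    using vnorm_le_ell2_norm[OF assms(1), of x] x assms(4) by (intro mult_left_mono) auto
  finally show "ell2_norm (mat_app A x) \<le> c" by simp
qed

text \<open>A crude bound by the sum of all entries. It serves to show that the supremum in
  \<open>op_norm\<close> is over a bounded set; a real \<open>SUP\<close> has no usable value
  otherwise.\<close>

lemma bilin_bound_exists: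
  assumes "finite F"
  obtains c where "c \<ge> 0" "bilin_bound F A c"
proof
  define c where "c = (\<Sum>m\<in>F. \<Sum>k\<in>F. cmod (A m k))"
  show "c \<ge> 0" by (simp add: c_def sum_nonneg)
  have "cmod (\<Sum>m\<in>F. \<Sum>k\<in>F. A m k * y m * x k) \<le> c * vnorm F y * vnorm F x" for x y
  proof -
    have "cmod (\<Sum>m\<in>F. \<Sum>k\<in>F. A m k * y m * x k) \<le> (\<Sum>m\<in>F. \<Sum>k\<in>F. cmod (A m k * y m * x k))"
      by (rule order_trans[OF norm_sum]) (intro sum_mono norm_sum)
    also have "\<dots> \<le> (\<Sum>m\<in>F. \<Sum>k\<in>F. cmod (A m k) * vnorm F y * vnorm F x)"
      unfolding norm_mult
      by (intro sum_mono mult_mono) (auto intro!: member_le_L2_set[where f = "\<lambda>i. cmod (_ i)"] assms)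
    also have "\<dots> = c * vnorm F y * vnorm F x"
      by (simp add: c_def sum_distrib_left sum_distrib_right)
    finally show ?thesis .
  qed
  then show "bilin_bound F A c" by (simp add: bilin_bound_def)
qed

lemma bdd_above_op_norm:
  assumes "finite F" "supported_on F A"
  shows "bdd_above ((\<lambda>x. ell2_norm (mat_app A x)) ` {x \<in> ell2. ell2_norm x \<le> 1})"
proof -
  obtain c where c: "c \<ge> 0" "bilin_bound F A c"
    using bilin_bound_exists[OF assms(1)] .
  show ?thesis
  proof (rule bdd_aboveI2)
    fix x assume x: "x \<in> {x \<in> ell2. ell2_norm x \<le> 1}"
    have "ell2_norm (mat_app A x) \<le> c * vnorm F x"
      using assms c by (simp add: ell2_norm_mat_app bilin_bound_imp_vnorm)
    also have "\<dots> \<le> c * 1"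
      using vnorm_le_ell2_norm[OF assms(1), of x] x c by (intro mult_left_mono) auto
    finally show "ell2_norm (mat_app A x) \<le> c" by simp
  qed
qed

lemma op_norm_nonneg:
  assumes "finite F" "supported_on F A"
  shows "op_norm A \<ge> 0"
proof -
  have "(\<lambda>i. 0) \<in> {x \<in> ell2. ell2_norm x \<le> 1}"
    by (simp add: ell2_def ell2_norm_def)
  from cSUP_upper[OF this bdd_above_op_norm[OF assms]]
  show ?thesis by (simp add: op_norm_def mat_app_def ell2_norm_def)
qed

text \<open>Only the values of x on F enter. Cut off outside F and divided by its norm r on F, x
  becomes an admissible vector for the supremum; if r = 0, then x vanishes on F.\<close>

lemma bilin_bound_op_norm:
  assumes F: "finite F" and A: "supported_on F A"
  shows "bilin_bound F A (op_norm A)"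
proof (rule vnorm_imp_bilin_bound)
  fix x :: "int \<Rightarrow> complex"
  define r where "r = vnorm F x"
  define z where "z = (\<lambda>i. if i \<in> F then x i / complex_of_real r else 0)"
  show "vnorm F (\<lambda>m. \<Sum>k\<in>F. A m k * x k) \<le> op_norm A * vnorm F x"
  proof (cases "r = 0")
    case True
    then have "\<forall>i\<in>F. x i = 0" using F by (simp add: r_def L2_set_eq_0_iff)
    then have "\<forall>m\<in>F. (\<Sum>k\<in>F. A m k * x k) = 0" by simp
    then have "vnorm F (\<lambda>m. \<Sum>k\<in>F. A m k * x k) = 0" by (intro L2_set_0') simp
    then show ?thesis using True by (simp add: r_def)
  next
    case False
    then have r: "r > 0" using L2_set_nonneg[of "\<lambda>i. cmod (x i)" F] by (simp add: r_def order.order_iff_strict)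
    have fin: "(\<lambda>i. (cmod (z i))\<^sup>2) summable_on UNIV"
    proof -
      have "(\<lambda>i. (cmod (z i))\<^sup>2) summable_on UNIV \<longleftrightarrow> (\<lambda>i. (cmod (z i))\<^sup>2) summable_on F"
        by (rule summable_on_cong_neutral) (auto simp: z_def)
      then show ?thesis using F by simp
    qed
    have "(\<Sum>\<^sub>\<infinity>i. (cmod (z i))\<^sup>2) = (\<Sum>i\<in>F. (cmod (z i))\<^sup>2)"
      by (rule infsum_finite_support[OF F]) (simp add: z_def)
    also have "\<dots> = (\<Sum>i\<in>F. (cmod (x i))\<^sup>2) / r\<^sup>2"
      by (simp add: z_def norm_divide power_divide flip: sum_divide_distrib)
    also have "\<dots> = 1"
      using r by (simp add: r_def flip: power2_vnorm)
    finally have z: "z \<in> {x \<in> ell2. ell2_norm x \<le> 1}"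
      using fin by (simp add: ell2_def ell2_norm_def)
    have "ell2_norm (mat_app A z) \<le> op_norm A"
      unfolding op_norm_def by (rule cSUP_upper[OF z bdd_above_op_norm[OF F A]])
    moreover have "vnorm F (\<lambda>m. \<Sum>k\<in>F. A m k * x k) = r * vnorm F (\<lambda>m. \<Sum>k\<in>F. A m k * z k)"
    proof -
      have "r * vnorm F (\<lambda>m. \<Sum>k\<in>F. A m k * z k) = vnorm F (\<lambda>m. complex_of_real r * (\<Sum>k\<in>F. A m k * z k))"
        using r by (simp add: L2_set_right_distrib norm_mult)
      also have "\<dots> = vnorm F (\<lambda>m. \<Sum>k\<in>F. A m k * x k)"
        using r by (intro vnorm_cong) (simp add: sum_distrib_left z_def)
      finally show ?thesis by simp
    qed
    ultimately show ?thesis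
      using r by (simp add: ell2_norm_mat_app[OF F A] r_def mult.commute mult_left_mono)
  qed
qed

section \<open>Squared moduli and the column BMO norm\<close>

lemma supported_on_fun_of_L: "supported_on F A \<Longrightarrow> supported_on F (fun_of_L \<Phi> A)"
  by (auto simp: supported_on_def fun_of_L_def)

lemma mat_abs_sq_supported:
  assumes "finite F" "supported_on F A"
  shows "mat_abs_sq A m k = (\<Sum>j\<in>F. cnj (A j m) * A j k)"
  unfolding mat_abs_sq_def mat_mult_def mat_adj_def
  using assms by (intro infsum_finite_support) (auto simp: supported_on_def)

lemma supported_on_mat_abs_sq:
  assumes "finite F" "supported_on F A"
  shows "supported_on F (mat_abs_sq A)"
  unfolding supported_on_def mat_abs_sq_supported[OF assms]
proof (intro allI impI)
  fix m k assume "(\<Sum>j\<in>F. cnj (A j m) * A j k) \<noteq> 0"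
  then obtain j where "cnj (A j m) * A j k \<noteq> 0" by (rule sum.not_neutral_contains_not_neutral)
  then show "m \<in> F \<and> k \<in> F" using assms(2) by (auto simp: supported_on_def)
qed

text \<open>The form of A^* A at y and x is the inner product of A applied to the conjugate of y
  with A x, so c enters twice.\<close>

lemma bilin_bound_mat_abs_sq:
  assumes F: "finite F" and A: "supported_on F A" and c: "c \<ge> 0" and b: "bilin_bound F A c"
  shows "bilin_bound F (mat_abs_sq A) (c\<^sup>2)"
  unfolding bilin_bound_def
proof (intro allI)
  fix x y :: "int \<Rightarrow> complex"
  have "(\<Sum>m\<in>F. \<Sum>k\<in>F. mat_abs_sq A m k * y m * x k)
      = (\<Sum>m\<in>F. \<Sum>k\<in>F. \<Sum>j\<in>F. (cnj (A j m) * y m) * (A j k * x k))"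
    by (simp add: mat_abs_sq_supported[OF F A] sum_distrib_left sum_distrib_right mult_ac)
  also have "\<dots> = (\<Sum>m\<in>F. \<Sum>j\<in>F. \<Sum>k\<in>F. (cnj (A j m) * y m) * (A j k * x k))"
    by (intro sum.cong refl sum.swap)
  also have "\<dots> = (\<Sum>j\<in>F. \<Sum>m\<in>F. \<Sum>k\<in>F. (cnj (A j m) * y m) * (A j k * x k))"
    by (rule sum.swap)
  also have "\<dots> = (\<Sum>j\<in>F. cnj (\<Sum>m\<in>F. A j m * cnj (y m)) * (\<Sum>k\<in>F. A j k * x k))"
    by (simp add: sum_product)
  also have "cmod \<dots> \<le> vnorm F (\<lambda>j. cnj (\<Sum>m\<in>F. A j m * cnj (y m))) * vnorm F (\<lambda>j. \<Sum>k\<in>F. A j k * x k)"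
    by (rule cmod_sum_mult_le)
  also have "vnorm F (\<lambda>j. cnj (\<Sum>m\<in>F. A j m * cnj (y m))) = vnorm F (\<lambda>j. (\<Sum>m\<in>F. A j m * cnj (y m)))"
    by (simp only: complex_mod_cnj)
  also have "vnorm F (\<lambda>j. (\<Sum>m\<in>F. A j m * cnj (y m))) * vnorm F (\<lambda>j. \<Sum>k\<in>F. A j k * x k)
      \<le> (c * vnorm F (\<lambda>m. cnj (y m))) * (c * vnorm F x)"
    using c by (intro mult_mono bilin_bound_imp_vnorm[OF b c]) auto
  finally show "cmod (\<Sum>m\<in>F. \<Sum>k\<in>F. mat_abs_sq A m k * y m * x k) \<le> c\<^sup>2 * vnorm F y * vnorm F x"
    by (simp add: power2_eq_square mult_ac)
qed

lemma bilin_bound_semigroup: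
  assumes "bilin_bound F A c" "c \<ge> 0" "t \<ge> 0"
  shows "bilin_bound F (semigroup_S t A) c"
  using bilin_bound_gaussian[OF assms] by (simp add: semigroup_S_def fun_of_L_def)

lemma bmo_col_norm_le:
  assumes F: "finite F" and A: "supported_on F A" and c: "c \<ge> 0" and b: "bilin_bound F A c"
  shows "bmo_col_norm A \<le> 2 * c"
  unfolding bmo_col_norm_def
proof (rule cSUP_least)
  fix t :: real assume "t \<in> {0<..}"
  then have t: "t \<ge> 0" by simp
  define D where "D = (\<lambda>m k. A m k - semigroup_S t A m k)"
  have D: "supported_on F D"
    using A by (auto simp: supported_on_def D_def semigroup_S_def fun_of_L_def)
  have "bilin_bound F D (c + c)"
    unfolding D_def by (intro bilin_bound_diff b bilin_bound_semigroup c t)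
  then have "bilin_bound F (semigroup_S t (mat_abs_sq D)) ((c + c)\<^sup>2)"
    using c by (intro bilin_bound_semigroup bilin_bound_mat_abs_sq F D t) auto
  then have "op_norm (semigroup_S t (mat_abs_sq D)) \<le> (c + c)\<^sup>2"
    by (intro op_norm_le[OF F])
      (auto simp: semigroup_S_def intro: supported_on_fun_of_L supported_on_mat_abs_sq F D)
  then show "sqrt (op_norm (semigroup_S t (mat_abs_sq D))) \<le> 2 * c"
    using c by (intro real_le_lsqrt) auto
qed simp

text \<open>For n >= 1 the terms at n and -n together give 2/(1+n^2) <= 4/(n(n+1)) = 4/n - 4/(n+1),
  which telescopes to at most 4. The term at n = 0 adds 1.\<close>

lemma sum_inverse_one_plus_square_le:
  fixes F :: "int set"
  assumes "finite F"
  shows "(\<Sum>k\<in>F. 1 / (1 + (real_of_int (m - k))\<^sup>2)) \<le> 5"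
proof -
  \<comment> \<open>The remainder 4/(N+1) of the telescoping sum makes the induction close; at N = 0
    both sides equal 1.\<close>
  have N: "(\<Sum>n\<in>{- int N..int N}. 1 / (1 + (real_of_int n)\<^sup>2)) \<le> 5 - 4 / real (N + 1)" for N :: nat
  proof (induction N)
    case (Suc N)
    have eq: "{- int (Suc N)..int (Suc N)} = insert (int (Suc N)) (insert (- int (Suc N)) {- int N..int N})"
      by auto
    have "(\<Sum>n\<in>{- int (Suc N)..int (Suc N)}. 1 / (1 + (real_of_int n)\<^sup>2))
        = 2 / (1 + (real (Suc N))\<^sup>2) + (\<Sum>n\<in>{- int N..int N}. 1 / (1 + (real_of_int n)\<^sup>2))"
      unfolding eq by (simp add: power2_eq_square algebra_simps)
    also have "\<dots> \<le> 2 / (1 + (real (Suc N))\<^sup>2) + (5 - 4 / real (N + 1))"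
      using Suc by simp
    also have "2 / (1 + (real (Suc N))\<^sup>2) \<le> 4 / (real (N + 1) * real (N + 2))"
    proof -
      have *: "2 / x \<le> 4 / y" if "2 * y \<le> 4 * x" "x > 0" "y > 0" for x y :: real
        using that by (simp add: field_simps)
      show ?thesis by (rule *) (auto simp: power2_eq_square algebra_simps add_pos_nonneg)
    qed
    also have "4 / (real (N + 1) * real (N + 2)) + (5 - 4 / real (N + 1)) = 5 - 4 / real (Suc N + 1)"
    proof -
      have *: "4 / (x * (x + 1)) + (5 - 4 / x) = 5 - 4 / (x + 1)" if "x > 0" for x :: real
        using diff_frac_eq[of x "x + 1" 4 4] that by simp
      have e: "real (N + 2) = real (N + 1) + 1" "real (Suc N + 1) = real (N + 1) + 1" by simp_all
      show ?thesis unfolding e by (rule *) simp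
    qed
    finally show ?case by simp
  qed simp
  \<comment> \<open>Translation by m reduces every row to the same sum over integers, so the bound
    does not depend on m.\<close>
  define G where "G = (\<lambda>k. m - k) ` F"
  have "(\<Sum>k\<in>F. 1 / (1 + (real_of_int (m - k))\<^sup>2)) = (\<Sum>n\<in>G. 1 / (1 + (real_of_int n)\<^sup>2))"
    unfolding G_def by (subst sum.reindex) (auto simp: inj_on_def)
  also obtain N :: nat where N': "G \<subseteq> {- int N..int N}"
  proof -
    have "finite G" using assms by (simp add: G_def)
    then have *: "\<bar>x\<bar> \<le> (\<Sum>n\<in>G. \<bar>n\<bar>)" if "x \<in> G" for x
      using that by (intro member_le_sum) auto
    have "G \<subseteq> {- int (nat (\<Sum>n\<in>G. \<bar>n\<bar>))..int (nat (\<Sum>n\<in>G. \<bar>n\<bar>))}"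
      using * by (force simp: sum_nonneg)
    then show thesis by (rule that)
  qed
  then have "(\<Sum>n\<in>G. 1 / (1 + (real_of_int n)\<^sup>2)) \<le> (\<Sum>n\<in>{- int N..int N}. 1 / (1 + (real_of_int n)\<^sup>2))"
    by (intro sum_mono2) auto
  also have "\<dots> \<le> 5 - 4 / real (N + 1)" by (rule N)
  also have "\<dots> \<le> 5" by simp
  finally show ?thesis .
qed

text \<open>The base of all powers that occur: the power s is the modulus of the symbol, 1/2 is the
  exponent at which rows are square summable, and theta/2 is the exponent reached by
  interpolation.\<close>

definition bessel_weight :: "int \<Rightarrow> int \<Rightarrow> real" where
  "bessel_weight m k = 1 / (1 + (real_of_int (m - k))\<^sup>2)"

lemma bessel_weight_pos: "bessel_weight m k > 0" and bessel_weight_le_1: "bessel_weight m k \<le> 1"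
  by (auto simp: bessel_weight_def add_pos_nonneg)

text \<open>At exponent 1/2 the squared entries of a row are dominated by the weights themselves,
  which sum to at most 5.\<close>

lemma bilin_bound_schur_weight:
  assumes A: "bilin_bound F A c" and c: "c \<ge> 0" and F: "finite F"
    and \<phi>: "\<And>m k. m \<in> F \<Longrightarrow> k \<in> F \<Longrightarrow> cmod (\<phi> m k) \<le> bessel_weight m k powr (1 / 2)"
  shows "bilin_bound F (\<lambda>m k. \<phi> m k * A m k) (sqrt 5 * c)"
proof (rule bilin_bound_schur_rows[OF A c F])
  fix m assume m: "m \<in> F"
  have "(cmod (\<phi> m k))\<^sup>2 \<le> bessel_weight m k" if "k \<in> F" for k
  proof -
    have "(cmod (\<phi> m k))\<^sup>2 \<le> (bessel_weight m k powr (1 / 2))\<^sup>2"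
      using \<phi>[OF m that] by (intro power_mono) auto
    then show ?thesis using bessel_weight_pos[of m k] by (simp add: powr_half_sqrt)
  qed
  then have "(\<Sum>k\<in>F. (cmod (\<phi> m k))\<^sup>2) \<le> (\<Sum>k\<in>F. bessel_weight m k)" by (rule sum_mono)
  also have "\<dots> \<le> 5"
    unfolding bessel_weight_def by (rule sum_inverse_one_plus_square_le[OF F])
  finally show "(\<Sum>k\<in>F. (cmod (\<phi> m k))\<^sup>2) \<le> 5" .
qed simp

definition schroedinger_symbol :: "real \<Rightarrow> real \<Rightarrow> int \<Rightarrow> int \<Rightarrow> complex" where
  "schroedinger_symbol s t m k = complex_of_real (bessel_weight m k powr s) * exp (\<i> * complex_of_real (t * (real_of_int (m - k))\<^sup>2))"

lemma bessel_schroedinger_eq: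
  "bessel_L s (schroedinger_L t A) = (\<lambda>m k. schroedinger_symbol s t m k * A m k)"
proof -
  have "(1 + (real_of_int \<bar>m - k\<bar>)\<^sup>2) powr - s = bessel_weight m k powr s" for m k
    by (simp add: bessel_weight_def powr_minus powr_divide inverse_eq_divide)
  then show ?thesis
    by (simp add: bessel_L_def schroedinger_L_def fun_of_L_def schroedinger_symbol_def mult.assoc)
qed

lemma cmod_schroedinger_symbol: "cmod (schroedinger_symbol s t m k) = bessel_weight m k powr s"
  by (simp add: schroedinger_symbol_def norm_mult)

lemma bmo_estimate:
  assumes "A \<in> fin_matrices" "s \<ge> 1 / 2"
  shows "bmo_col_norm (bessel_L s (schroedinger_L t A)) \<le> 2 * sqrt 5 * op_norm A"
proof -
  obtain F where F: "finite F" "supported_on F A"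
    using assms(1) by (rule fin_matrices_supported)
  have "cmod (schroedinger_symbol s t m k) \<le> bessel_weight m k powr (1 / 2)" for m k
    unfolding cmod_schroedinger_symbol using assms(2) bessel_weight_pos bessel_weight_le_1 by (intro powr_mono') (auto simp: less_imp_le)
  then have "bilin_bound F (\<lambda>m k. schroedinger_symbol s t m k * A m k) (sqrt 5 * op_norm A)"
    using F by (intro bilin_bound_schur_weight bilin_bound_op_norm op_norm_nonneg[OF F])
  then have "bmo_col_norm (bessel_L s (schroedinger_L t A)) \<le> 2 * (sqrt 5 * op_norm A)"
    unfolding bessel_schroedinger_eq
    using F op_norm_nonneg[OF F]
    by (intro bmo_col_norm_le[OF F(1)]) (auto simp: supported_on_def)
  then show ?thesis by simp
qed

section \<open>Singular value decomposition and Schatten norms\<close>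

definition inner_on :: "'a set \<Rightarrow> ('a \<Rightarrow> complex) \<Rightarrow> ('a \<Rightarrow> complex) \<Rightarrow> complex" where
  "inner_on F x y = (\<Sum>m\<in>F. cnj (x m) * y m)"

definition apply_on :: "'a set \<Rightarrow> ('a \<Rightarrow> 'a \<Rightarrow> complex) \<Rightarrow> ('a \<Rightarrow> complex) \<Rightarrow> 'a \<Rightarrow> complex" where
  "apply_on F A x = (\<lambda>m. \<Sum>k\<in>F. A m k * x k)"

definition orthonormal_on :: "'a set \<Rightarrow> nat \<Rightarrow> (nat \<Rightarrow> 'a \<Rightarrow> complex) \<Rightarrow> bool" where
  "orthonormal_on F n u \<longleftrightarrow> (\<forall>i<n. \<forall>j<n. inner_on F (u i) (u j) = (if i = j then 1 else 0))"

lemma inner_on_diff_sum_right: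
  "inner_on F x (\<lambda>m. y m - (\<Sum>i\<in>I. c i * u i m)) = inner_on F x y - (\<Sum>i\<in>I. c i * inner_on F x (u i))"
proof -
  have "(\<Sum>m\<in>F. cnj (x m) * (\<Sum>i\<in>I. c i * u i m)) = (\<Sum>m\<in>F. \<Sum>i\<in>I. c i * (cnj (x m) * u i m))"
    by (simp add: sum_distrib_left mult_ac)
  also have "\<dots> = (\<Sum>i\<in>I. c i * (\<Sum>m\<in>F. cnj (x m) * u i m))"
    by (subst sum.swap) (simp add: sum_distrib_left)
  finally show ?thesis
    by (simp add: inner_on_def right_diff_distrib sum_subtractf)
qed

lemma inner_on_cnj: "cnj (inner_on F x y) = inner_on F y x"
  by (simp add: inner_on_def mult.commute)

lemma inner_on_mult_right: "inner_on F x (\<lambda>m. c * y m) = c * inner_on F x y"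
  by (simp add: inner_on_def sum_distrib_left mult_ac)

lemma inner_on_mult_left: "inner_on F (\<lambda>m. c * x m) y = cnj c * inner_on F x y"
  by (simp add: inner_on_def sum_distrib_left mult_ac)

lemma inner_on_self: "inner_on F x x = complex_of_real ((vnorm F x)\<^sup>2)"
  unfolding inner_on_def power2_vnorm_complex ..

lemma power2_vnorm_add:
  "(vnorm F (\<lambda>m. x m + c * y m))\<^sup>2
    = (vnorm F x)\<^sup>2 + 2 * Re (c * inner_on F x y) + (cmod c)\<^sup>2 * (vnorm F y)\<^sup>2"
proof -
  have "(cmod (a + c * b))\<^sup>2 = (cmod a)\<^sup>2 + 2 * Re (c * (cnj a * b)) + (cmod c)\<^sup>2 * (cmod b)\<^sup>2" for a b
    by (simp only: cmod_power2) (simp add: power2_eq_square algebra_simps)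
  then show ?thesis
    by (simp add: power2_vnorm inner_on_def sum.distrib sum_distrib_left Re_sum)
qed

lemma orthonormal_on_residual:
  assumes "orthonormal_on F n u" "i < n"
  shows "inner_on F (u i) (\<lambda>m. x m - (\<Sum>j<n. inner_on F (u j) x * u j m)) = 0"
proof -
  have "(\<Sum>j<n. inner_on F (u j) x * inner_on F (u i) (u j))
      = (\<Sum>j<n. if j = i then inner_on F (u j) x else 0)"
    using assms by (intro sum.cong) (auto simp: orthonormal_on_def)
  then show ?thesis
    using assms(2) by (simp add: inner_on_diff_sum_right)
qed

text \<open>The residual after projection is orthogonal to all u_i, so its squared norm is the
  difference of the two sides.\<close>

lemma bessel_inequality:
  assumes "orthonormal_on F n u"
  shows "(\<Sum>i<n. (cmod (inner_on F (u i) x))\<^sup>2) \<le> (vnorm F x)\<^sup>2"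
proof -
  define r where "r = (\<lambda>m. x m - (\<Sum>j<n. inner_on F (u j) x * u j m))"
  have ur: "inner_on F (u i) r = 0" if "i < n" for i
    unfolding r_def by (rule orthonormal_on_residual[OF assms that])
  have ru: "inner_on F r (u i) = 0" if "i < n" for i
    using ur[OF that] inner_on_cnj[of F "u i" r] by simp
  have "inner_on F r r = inner_on F r x - (\<Sum>j<n. inner_on F (u j) x * inner_on F r (u j))"
    by (subst (2) r_def) (rule inner_on_diff_sum_right)
  also have "\<dots> = cnj (inner_on F x r)"
    using ru by (simp add: inner_on_cnj)
  also have "inner_on F x r = inner_on F x x - (\<Sum>j<n. inner_on F (u j) x * inner_on F x (u j))"
    unfolding r_def by (rule inner_on_diff_sum_right)
  also have "(\<Sum>j<n. inner_on F (u j) x * inner_on F x (u j))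
      = (\<Sum>j<n. complex_of_real ((cmod (inner_on F (u j) x))\<^sup>2))"
    by (intro sum.cong refl) (simp only: complex_norm_square inner_on_cnj)
  finally have "complex_of_real ((vnorm F r)\<^sup>2)
      = complex_of_real ((vnorm F x)\<^sup>2 - (\<Sum>j<n. (cmod (inner_on F (u j) x))\<^sup>2))"
    by (simp add: inner_on_self)
  then have "(vnorm F r)\<^sup>2 = (vnorm F x)\<^sup>2 - (\<Sum>j<n. (cmod (inner_on F (u j) x))\<^sup>2)"
    by (simp only: of_real_eq_iff)
  then show ?thesis by (smt (verit) zero_le_power2)
qed

lemma inner_on_unit:
  "finite F \<Longrightarrow> k \<in> F \<Longrightarrow> inner_on F x (\<lambda>m. if m = k then 1 else 0) = cnj (x k)"
  by (simp add: inner_on_def if_distrib[of "\<lambda>t. _ * t"] cong: if_cong)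

lemma vnorm_orthonormal:
  assumes "orthonormal_on F n u" "i < n"
  shows "vnorm F (u i) = 1"
proof -
  have "complex_of_real ((vnorm F (u i))\<^sup>2) = complex_of_real 1"
    unfolding inner_on_self[symmetric] using assms by (simp add: orthonormal_on_def)
  then show ?thesis
    using L2_set_nonneg[of "\<lambda>m. cmod (u i m)" F] unfolding of_real_eq_iff by (simp add: power2_eq_1_iff)
qed

text \<open>Sum Bessel's inequality for the unit vectors e_k over k in F: the left side adds up to
  n. This bounds the length of the singular families built below.\<close>

lemma orthonormal_on_le_card:
  assumes F: "finite F" and u: "orthonormal_on F n u"
  shows "n \<le> card F"
proof -
  have "real n = (\<Sum>i<n. (vnorm F (u i))\<^sup>2)"
    by (simp add: vnorm_orthonormal[OF u])
  also have "\<dots> = (\<Sum>k\<in>F. \<Sum>i<n. (cmod (u i k))\<^sup>2)"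
    unfolding power2_vnorm by (rule sum.swap)
  also have "\<dots> \<le> (\<Sum>k\<in>F. 1)"
  proof (rule sum_mono)
    fix k assume k: "k \<in> F"
    have e: "(vnorm F (\<lambda>m. if m = k then 1 else 0))\<^sup>2 = 1"
    proof -
      have "(\<Sum>m\<in>F. (cmod (if m = k then 1 else 0))\<^sup>2) = (\<Sum>m\<in>F. if m = k then 1 else 0)"
        by (intro sum.cong) auto
      then show ?thesis using F k by (simp add: power2_vnorm)
    qed
    show "(\<Sum>i<n. (cmod (u i k))\<^sup>2) \<le> 1"
      using bessel_inequality[OF u, of "\<lambda>m. if m = k then 1 else 0"] unfolding e
      by (simp add: inner_on_unit F k)
  qed
  finally show ?thesis by simp
qed

section \<open>Singular vectors as maximisers\<close>

lemma apply_on_add: "apply_on F A (\<lambda>m. x m + c * y m) = (\<lambda>m. apply_on F A x m + c * apply_on F A y m)"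
  by (simp add: apply_on_def sum.distrib sum_distrib_left algebra_simps)

lemma apply_on_mult: "apply_on F A (\<lambda>m. c * x m) = (\<lambda>m. c * apply_on F A x m)"
  by (simp add: apply_on_def sum_distrib_left algebra_simps)

lemma apply_on_cong: "(\<And>k. k \<in> F \<Longrightarrow> x k = y k) \<Longrightarrow> apply_on F A x = apply_on F A y"
  by (simp add: apply_on_def)

lemma vnorm_mult: "vnorm F (\<lambda>m. c * x m) = cmod c * vnorm F x"
  by (simp add: L2_set_right_distrib norm_mult)

text \<open>First variation. Since w is orthogonal to z, the norm of z + c w changes only to second
  order in c, so the first-order change 2 Re(c g) of the squared norm of A(z + c w) must vanish at a
  maximiser.\<close>

lemma maximizer_orthogonal:
  assumes M: "\<And>x. P x \<Longrightarrow> vnorm F (apply_on F A x) \<le> vnorm F (apply_on F A z) * vnorm F x"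
    and P: "\<And>c. P (\<lambda>m. z m + c * w m)"
    and z: "vnorm F z = 1" and zw: "inner_on F z w = 0"
  shows "inner_on F (apply_on F A z) (apply_on F A w) = 0"
proof -
  define g where "g = inner_on F (apply_on F A z) (apply_on F A w)"
  define l where "l = (vnorm F (apply_on F A z))\<^sup>2"
  define M where "M = l * (vnorm F w)\<^sup>2"
  have M0: "M \<ge> 0" by (simp add: M_def l_def)
  have *: "2 * Re (c * g) \<le> (cmod c)\<^sup>2 * M" for c
  proof -
    let ?x = "\<lambda>m. z m + c * w m"
    have "(vnorm F (apply_on F A ?x))\<^sup>2 \<le> (vnorm F (apply_on F A z) * vnorm F ?x)\<^sup>2"
      using assms(1)[OF P] by (intro power_mono) auto
    also have "\<dots> = l * (1 + (cmod c)\<^sup>2 * (vnorm F w)\<^sup>2)"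
      by (simp add: power_mult_distrib l_def power2_vnorm_add z zw)
    finally have "l + 2 * Re (c * g) + (cmod c)\<^sup>2 * (vnorm F (apply_on F A w))\<^sup>2
        \<le> l * (1 + (cmod c)\<^sup>2 * (vnorm F w)\<^sup>2)"
      by (simp add: apply_on_add power2_vnorm_add g_def l_def)
    moreover have "(cmod c)\<^sup>2 * (vnorm F (apply_on F A w))\<^sup>2 \<ge> 0" by simp
    moreover have "l * (1 + (cmod c)\<^sup>2 * (vnorm F w)\<^sup>2) = l + (cmod c)\<^sup>2 * M"
      by (simp add: M_def algebra_simps)
    ultimately show ?thesis by linarith
  qed
  \<comment> \<open>The choice c = e cnj(g) makes the linear term 2 e |g|^2. As e M <= 1, the
    quadratic term is at most e |g|^2, which forces g = 0.\<close>
  define e where "e = 1 / (1 + M)"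
  have e: "e > 0" "e * M \<le> 1" using M0 by (auto simp: e_def)
  have "complex_of_real e * cnj g * g = complex_of_real (e * (cmod g)\<^sup>2)"
    by (simp add: complex_norm_square mult_ac del: of_real_power)
  then have "Re (complex_of_real e * cnj g * g) = e * (cmod g)\<^sup>2"
    by (simp only: Re_complex_of_real)
  then have "2 * (e * (cmod g)\<^sup>2) \<le> (cmod (complex_of_real e * cnj g))\<^sup>2 * M"
    using *[of "complex_of_real e * cnj g"] by (simp only:)
  also have "\<dots> = e\<^sup>2 * (cmod g)\<^sup>2 * M"
    by (simp add: norm_mult power_mult_distrib)
  finally have "2 * (e * (cmod g)\<^sup>2) \<le> e\<^sup>2 * (cmod g)\<^sup>2 * M" .
  also have "\<dots> = e * (cmod g)\<^sup>2 * (e * M)" by (simp add: power2_eq_square)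
  also have "\<dots> \<le> e * (cmod g)\<^sup>2 * 1"
    using e by (intro mult_left_mono) auto
  finally have "e * (cmod g)\<^sup>2 \<le> 0" by simp
  then have "g = 0" using e(1) by (simp add: mult_le_0_iff)
  then show ?thesis by (simp add: g_def)
qed

text \<open>On the orthogonal complement of the u_i the norm of A is attained, by compactness. The
  vector w makes the set of candidates nonempty and the maximum positive.\<close>

lemma maximizer_exists:
  fixes F :: "'a set" and A :: "'a \<Rightarrow> 'a \<Rightarrow> complex"
  assumes F: "finite F"
    and w: "\<And>i. i < n \<Longrightarrow> inner_on F (u i) w = 0" "vnorm F (apply_on F A w) \<noteq> 0"
  shows "\<exists>z. vnorm F z = 1 \<and> (\<forall>m. m \<notin> F \<longrightarrow> z m = 0) \<and> (\<forall>i<n. inner_on F (u i) z = 0) \<and>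
    vnorm F (apply_on F A z) > 0 \<and>
    (\<forall>x. (\<forall>i<n. inner_on F (u i) x = 0) \<longrightarrow>
       vnorm F (apply_on F A x) \<le> vnorm F (apply_on F A z) * vnorm F x)"
proof -
  \<comment> \<open>Functions on the index type carry the product topology, so compactness comes
    from Tychonoff: values in the closed unit disc on F and 0 elsewhere. The unit sphere and the
    orthogonality relations are closed conditions, which cut out V.\<close>
  define W where "W = (PiE UNIV (\<lambda>m. if m \<in> F then cball 0 1 else {0}) :: ('a \<Rightarrow> complex) set)"
  define V where "V = W \<inter> ({x. (\<Sum>m\<in>F. (cmod (x m))\<^sup>2) = 1} \<inter> (\<Inter>i\<in>{..<n}. {x. inner_on F (u i) x = 0}))"
  have V_iff: "x \<in> V \<longleftrightarrow> (\<forall>m. m \<notin> F \<longrightarrow> x m = 0) \<and> vnorm F x = 1 \<and> (\<forall>i<n. inner_on F (u i) x = 0)" for x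
  proof -
    have "cmod (x m) \<le> 1" if "vnorm F x = 1" "m \<in> F" for m
      using member_le_L2_set[OF F that(2), of "\<lambda>i. cmod (x i)"] that(1) by simp
    then show ?thesis
      by (auto simp: V_def W_def PiE_iff L2_set_def split: if_splits)
  qed
  have "compactin (product_topology (\<lambda>i. euclidean) UNIV) W"
    unfolding W_def compactin_PiE by auto
  then have "compact W" by (simp add: euclidean_product_topology)
  moreover have "closed {x :: 'a \<Rightarrow> complex. (\<Sum>m\<in>F. (cmod (x m))\<^sup>2) = 1}"
    by (intro closed_Collect_eq continuous_intros continuous_on_product_coordinates)
  moreover have "closed {x :: 'a \<Rightarrow> complex. inner_on F (u i) x = 0}" for i
    unfolding inner_on_def
    by (intro closed_Collect_eq continuous_intros continuous_on_product_coordinates)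
  ultimately have "compact V"
    unfolding V_def by (intro compact_Int_closed closed_Int closed_INT) auto
  \<comment> \<open>Normalisation onto the unit sphere, with values off F reset to 0 so that the
    result lies in V.\<close>
  define rs where "rs = (\<lambda>x :: 'a \<Rightarrow> complex. \<lambda>m. if m \<in> F then x m / complex_of_real (vnorm F x) else 0)"
  have rs: "rs x \<in> V" "vnorm F (apply_on F A x) = vnorm F (apply_on F A (rs x)) * vnorm F x"
    if x: "\<And>i. i < n \<Longrightarrow> inner_on F (u i) x = 0" "vnorm F x \<noteq> 0" for x
  proof -
    define r where "r = complex_of_real (inverse (vnorm F x))"
    have eq: "rs x m = r * x m" if "m \<in> F" for m
      using that by (simp add: rs_def r_def field_simps)
    have r: "cmod r = inverse (vnorm F x)"
      unfolding r_def norm_of_real by simp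
    have "vnorm F (rs x) = vnorm F (\<lambda>m. r * x m)"
      by (intro vnorm_cong eq)
    also have "\<dots> = 1" using x(2) by (simp add: vnorm_mult r)
    finally have n1: "vnorm F (rs x) = 1" .
    have "inner_on F (u i) (rs x) = inner_on F (u i) (\<lambda>m. r * x m)" for i
      by (simp add: inner_on_def eq)
    then show "rs x \<in> V"
      using x n1 by (auto simp: V_iff inner_on_mult_right) (auto simp: rs_def)
    have "apply_on F A (rs x) = apply_on F A (\<lambda>m. r * x m)"
      by (intro apply_on_cong eq)
    then show "vnorm F (apply_on F A x) = vnorm F (apply_on F A (rs x)) * vnorm F x"
      using x(2) by (simp add: apply_on_mult vnorm_mult r)
  qed
  have zero: "vnorm F (apply_on F A x) = 0" if "vnorm F x = 0" for x
  proof -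
    have "\<forall>m\<in>F. x m = 0" using that F by (simp add: L2_set_eq_0_iff)
    then show ?thesis by (simp add: apply_on_def L2_set_def)
  qed
  have wn: "vnorm F w \<noteq> 0" using zero w(2) by blast
  have "continuous_on V (\<lambda>x. vnorm F (apply_on F A x))"
    unfolding apply_on_def L2_set_def
    by (intro continuous_intros continuous_on_subset[OF continuous_on_product_coordinates]) auto
  then obtain z where z: "z \<in> V" "\<And>x. x \<in> V \<Longrightarrow> vnorm F (apply_on F A x) \<le> vnorm F (apply_on F A z)"
    using continuous_attains_sup[OF \<open>compact V\<close>] rs(1)[OF w(1) wn] by blast
  show ?thesis
  proof (intro exI[of _ z] conjI allI impI)
    have "0 < vnorm F (apply_on F A (rs w))"
      using rs(2)[OF w(1) wn] w(2)  by (metis L2_set_nonneg mult_zero_left order.order_iff_strict)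
    also have "\<dots> \<le> vnorm F (apply_on F A z)"
      by (intro z rs w wn)
    finally show "0 < vnorm F (apply_on F A z)" .
    show "vnorm F (apply_on F A x) \<le> vnorm F (apply_on F A z) * vnorm F x"
      if x: "\<forall>i<n. inner_on F (u i) x = 0" for x
    proof (cases "vnorm F x = 0")
      case True
      then show ?thesis using zero by simp
    next
      case False
      then show ?thesis
        using rs(2)[OF x[rule_format] False] z(2)[OF rs(1)[OF x[rule_format] False]] by (simp add: mult_right_mono)
    qed
  qed (use z(1) in \<open>auto simp: V_iff\<close>)
qed

text \<open>The last clause is the invariant of the construction: on F, the span of the u_i is
  invariant under A^* A. A further vector orthogonal to the u_i then automatically has an image
  orthogonal to the A u_i.\<close>

definition svd_family :: "'a set \<Rightarrow> ('a \<Rightarrow> 'a \<Rightarrow> complex) \<Rightarrow> nat \<Rightarrow> (nat \<Rightarrow> 'a \<Rightarrow> complex) \<Rightarrow> bool" where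
  "svd_family F A n u \<longleftrightarrow> orthonormal_on F n u \<and>
     (\<forall>i<n. (\<forall>m. m \<notin> F \<longrightarrow> u i m = 0) \<and> vnorm F (apply_on F A (u i)) > 0) \<and>
     (\<forall>i<n. \<forall>j<n. i \<noteq> j \<longrightarrow> inner_on F (apply_on F A (u i)) (apply_on F A (u j)) = 0) \<and>
     (\<forall>w. (\<forall>i<n. inner_on F (u i) w = 0) \<longrightarrow>
        (\<forall>i<n. inner_on F (apply_on F A (u i)) (apply_on F A w) = 0))"

text \<open>The new right singular vector maximises the norm of A x on the complement of the old
  ones, and \<open>maximizer_orthogonal\<close> restores the invariant for it.\<close>

lemma svd_family_extend:
  assumes F: "finite F" and u: "svd_family F A n u"
    and w: "\<And>i. i < n \<Longrightarrow> inner_on F (u i) w = 0" "vnorm F (apply_on F A w) \<noteq> 0"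
  shows "\<exists>u'. svd_family F A (Suc n) u'"
proof -
  from maximizer_exists[where u = u and n = n and A = A, OF F w]
  have "\<exists>z. vnorm F z = 1 \<and> (\<forall>m. m \<notin> F \<longrightarrow> z m = 0) \<and> (\<forall>i<n. inner_on F (u i) z = 0) \<and>
    vnorm F (apply_on F A z) > 0 \<and>
    (\<forall>x. (\<forall>i<n. inner_on F (u i) x = 0) \<longrightarrow>
       vnorm F (apply_on F A x) \<le> vnorm F (apply_on F A z) * vnorm F x)" by simp
  then obtain z where z: "vnorm F z = 1" "\<forall>m. m \<notin> F \<longrightarrow> z m = 0" "\<forall>i<n. inner_on F (u i) z = 0"
      "vnorm F (apply_on F A z) > 0"
    and max: "\<forall>x. (\<forall>i<n. inner_on F (u i) x = 0) \<longrightarrow>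
       vnorm F (apply_on F A x) \<le> vnorm F (apply_on F A z) * vnorm F x"
    by blast
  have zu: "inner_on F z (u i) = 0" if "i < n" for i
    using z(3) that inner_on_cnj[of F "u i" z] by simp
  have Auz: "inner_on F (apply_on F A (u i)) (apply_on F A z) = 0" if "i < n" for i
    using u z(3) that by (auto simp: svd_family_def)
  have Azu: "inner_on F (apply_on F A z) (apply_on F A (u i)) = 0" if "i < n" for i
    using Auz[OF that] inner_on_cnj[of F "apply_on F A (u i)" "apply_on F A z"] by simp
  have Azw: "inner_on F (apply_on F A z) (apply_on F A y) = 0"
    if y: "\<forall>i<n. inner_on F (u i) y = 0" "inner_on F z y = 0" for y
  proof (rule maximizer_orthogonal[where P = "\<lambda>x. \<forall>i<n. inner_on F (u i) x = 0"])
    fix c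
    have "inner_on F (u i) (\<lambda>m. z m + c * y m) = inner_on F (u i) z + c * inner_on F (u i) y" for i
      by (simp add: inner_on_def sum.distrib sum_distrib_left algebra_simps)
    then show "\<forall>i<n. inner_on F (u i) (\<lambda>m. z m + c * y m) = 0"
      using y z(3) by simp
  qed (use z y max in auto)
  have zz: "inner_on F z z = 1" by (simp add: inner_on_self z(1))
  have "svd_family F A (Suc n) (u(n := z))"
    using u z(2,3,4) zu zz Auz Azu Azw
    unfolding svd_family_def orthonormal_on_def by (auto simp: less_Suc_eq)
  then show ?thesis by blast
qed

text \<open>A singular family of maximal length exists because \<open>card F\<close> bounds the
  length. By maximality A vanishes on its orthogonal complement, so the images A u_i determine A.
  Their norms are the singular values, and normalised they are the left singular vectors.\<close>

lemma svd_exists: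
  fixes F :: "'a set"
  assumes F: "finite F" and A: "supported_on F A"
  obtains n \<sigma> v u where "\<And>i. i < n \<Longrightarrow> \<sigma> i > (0::real)" "orthonormal_on F n v" "orthonormal_on F n u"
    "\<And>i m. i < n \<Longrightarrow> m \<notin> F \<Longrightarrow> u i m = 0"
    "A = (\<lambda>m k. \<Sum>i<n. complex_of_real (\<sigma> i) * v i m * cnj (u i k))"
proof -
  define P where "P n \<longleftrightarrow> (\<exists>u. svd_family F A n u)" for n
  define n where "n = (GREATEST n. P n)"
  have P0: "P 0" by (simp add: P_def svd_family_def orthonormal_on_def)
  have bd: "\<forall>k. P k \<longrightarrow> k \<le> card F"
    using orthonormal_on_le_card[OF F] by (auto simp: P_def svd_family_def)
  have Pn: "P n" unfolding n_def by (rule GreatestI_nat[of P, OF P0]) (use bd in auto)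
  have "\<not> P (Suc n)"
    using Greatest_le_nat[of P "Suc n" "card F"] bd by (auto simp: n_def)
  obtain u where u: "svd_family F A n u" using Pn by (auto simp: P_def)
  have on: "orthonormal_on F n u" using u by (simp add: svd_family_def)
  have van: "vnorm F (apply_on F A w) = 0" if "\<And>i. i < n \<Longrightarrow> inner_on F (u i) w = 0" for w
    using svd_family_extend[OF F u that] \<open>\<not> P (Suc n)\<close> by (auto simp: P_def)
  have AF: "A m k = (\<Sum>i<n. cnj (u i k) * apply_on F A (u i) m)" if m: "m \<in> F" and k: "k \<in> F" for m k
  proof -
    \<comment> \<open>Column k of A is A e_k. The residual w of e_k is orthogonal to all u_i and
      hence killed by A, which leaves the expansion of the column over the A u_i.\<close>
    define e where "e = (\<lambda>j. if j = k then 1 else 0 :: complex)"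
    define w where "w = (\<lambda>j. e j - (\<Sum>i<n. inner_on F (u i) e * u i j))"
    have ie: "inner_on F (u i) e = cnj (u i k)" for i
      unfolding e_def by (rule inner_on_unit[OF F k])
    have "vnorm F (apply_on F A w) = 0"
      by (rule van) (simp add: w_def orthonormal_on_residual[OF on])
    then have "apply_on F A w m = 0" using F m by (simp add: L2_set_eq_0_iff)
    moreover have "apply_on F A w m = apply_on F A e m - (\<Sum>i<n. cnj (u i k) * apply_on F A (u i) m)"
    proof -
      have "(\<Sum>j\<in>F. A m j * (\<Sum>i<n. cnj (u i k) * u i j)) = (\<Sum>j\<in>F. \<Sum>i<n. cnj (u i k) * (A m j * u i j))"
        by (simp add: sum_distrib_left mult_ac)
      also have "\<dots> = (\<Sum>i<n. cnj (u i k) * (\<Sum>j\<in>F. A m j * u i j))"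
        by (subst sum.swap) (simp add: sum_distrib_left)
      finally show ?thesis
        by (simp add: apply_on_def w_def ie right_diff_distrib sum_subtractf)
    qed
    moreover have "apply_on F A e m = A m k"
      using F k by (simp add: apply_on_def e_def if_distrib[of "\<lambda>t. _ * t"] cong: if_cong)
    ultimately show ?thesis by simp
  qed
  define \<sigma> where "\<sigma> i = vnorm F (apply_on F A (u i))" for i
  define v where "v i m = complex_of_real (inverse (\<sigma> i)) * apply_on F A (u i) m" for i m
  have \<sigma>: "\<sigma> i > 0" if "i < n" for i using u that by (simp add: \<sigma>_def svd_family_def)
  show thesis
  proof
    show "orthonormal_on F n v"
      unfolding orthonormal_on_def
    proof (intro allI impI)
      fix i j assume ij: "i < n" "j < n"
      have eq: "inner_on F (v i) (v j) = complex_of_real (inverse (\<sigma> i)) * (complex_of_real (inverse (\<sigma> j))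
          * inner_on F (apply_on F A (u i)) (apply_on F A (u j)))"
        unfolding v_def inner_on_mult_left inner_on_mult_right by simp
      show "inner_on F (v i) (v j) = (if i = j then 1 else 0)"
      proof (cases "i = j")
        case True
        have "inner_on F (apply_on F A (u j)) (apply_on F A (u j)) = complex_of_real (\<sigma> j) * complex_of_real (\<sigma> j)"
          by (simp add: inner_on_self \<sigma>_def power2_eq_square)
        with eq have "inner_on F (v i) (v j) = complex_of_real (inverse (\<sigma> j)) * (complex_of_real (inverse (\<sigma> j))
            * (complex_of_real (\<sigma> j) * complex_of_real (\<sigma> j)))"
          unfolding True by (simp only:)
        then show ?thesis using \<sigma>[OF ij(2)] True by (simp add: field_simps)
      next
        case False
        then have "inner_on F (apply_on F A (u i)) (apply_on F A (u j)) = 0"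
          using u ij unfolding svd_family_def by blast
        then show ?thesis using False unfolding eq by simp
      qed
    qed
    show "u i m = 0" if "i < n" "m \<notin> F" for i m
      using u that by (auto simp: svd_family_def)
    show "A = (\<lambda>m k. \<Sum>i<n. complex_of_real (\<sigma> i) * v i m * cnj (u i k))"
    proof (intro ext)
      fix m k
      have Au: "complex_of_real (\<sigma> i) * v i m = apply_on F A (u i) m" if "i < n" for i
        using \<sigma>[OF that] by (simp add: v_def)
      show "A m k = (\<Sum>i<n. complex_of_real (\<sigma> i) * v i m * cnj (u i k))"
      proof (cases "m \<in> F \<and> k \<in> F")
        case True
        then show ?thesis using Au by (simp add: AF mult.commute)
      next
        case False
        then have "A m k = 0" using A by (auto simp: supported_on_def)
        moreover have "u i k = 0 \<or> apply_on F A (u i) m = 0" if "i < n" for i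
        proof (cases "m \<in> F")
          case True
          then show ?thesis using False u that by (auto simp: svd_family_def)
        next
          case mF: False
          then have "A m j = 0" for j using A by (auto simp: supported_on_def)
          then show ?thesis by (simp add: apply_on_def)
        qed
        then have "(\<Sum>i<n. complex_of_real (\<sigma> i) * v i m * cnj (u i k)) = 0"
          using Au by (intro sum.neutral) auto
        ultimately show ?thesis by simp
      qed
    qed
  qed (use \<sigma> on in auto)
qed

section \<open>Powers of positive matrices and Schatten norms\<close>

definition spectral_on ::
  "'a set \<Rightarrow> ('a \<Rightarrow> 'a \<Rightarrow> complex) \<Rightarrow> nat \<Rightarrow> (nat \<Rightarrow> real) \<Rightarrow> (nat \<Rightarrow> 'a \<Rightarrow> complex) \<Rightarrow> bool" where
  "spectral_on F P n l u \<longleftrightarrow> (\<forall>i<n. l i > 0 \<and> (\<forall>m. m \<notin> F \<longrightarrow> u i m = 0)) \<and> orthonormal_on F n u \<and>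
     P = (\<lambda>m k. \<Sum>i<n. complex_of_real (l i) * u i m * cnj (u i k))"

lemma spectral_on_apply:
  assumes "spectral_on F P n l u"
  shows "apply_on F P x m = (\<Sum>i<n. complex_of_real (l i) * inner_on F (u i) x * u i m)"
proof -
  have "apply_on F P x m = (\<Sum>k\<in>F. \<Sum>i<n. complex_of_real (l i) * u i m * cnj (u i k) * x k)"
    using assms by (simp add: spectral_on_def apply_on_def sum_distrib_right)
  also have "\<dots> = (\<Sum>i<n. \<Sum>k\<in>F. complex_of_real (l i) * u i m * cnj (u i k) * x k)"
    by (rule sum.swap)
  finally show ?thesis
    by (simp add: inner_on_def sum_distrib_left sum_distrib_right mult_ac)
qed

lemma spectral_on_eigen:
  assumes "spectral_on F P n l u" "j < n"
  shows "apply_on F P (u j) m = complex_of_real (l j) * u j m"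
proof -
  have "apply_on F P (u j) m = (\<Sum>i<n. if i = j then complex_of_real (l i) * u i m else 0)"
    unfolding spectral_on_apply[OF assms(1)]
    using assms by (intro sum.cong) (auto simp: spectral_on_def orthonormal_on_def)
  then show ?thesis using assms(2) by simp
qed

lemma spectral_on_inner:
  assumes "spectral_on F P n l u" "j < n"
  shows "inner_on F (u j) (apply_on F P x) = complex_of_real (l j) * inner_on F (u j) x"
proof -
  have "inner_on F (u j) (apply_on F P x)
      = (\<Sum>m\<in>F. \<Sum>i<n. complex_of_real (l i) * inner_on F (u i) x * (cnj (u j m) * u i m))"
    by (simp add: inner_on_def[of F "u j" "apply_on F P x"] spectral_on_apply[OF assms(1)] sum_distrib_left mult_ac)
  also have "\<dots> = (\<Sum>i<n. complex_of_real (l i) * inner_on F (u i) x * inner_on F (u j) (u i))"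
    by (subst sum.swap) (simp add: sum_distrib_left inner_on_def[of F "u j"])
  also have "\<dots> = (\<Sum>i<n. if i = j then complex_of_real (l i) * inner_on F (u i) x else 0)"
    using assms by (intro sum.cong) (auto simp: spectral_on_def orthonormal_on_def)
  finally show ?thesis using assms(2) by simp
qed

text \<open>
  Both sides equal $\sum_{i,j} l_i^r \langle w_j, u_i\rangle\, w_j u_i^*$, because
  $\langle w_j, u_i\rangle \neq 0$ forces $l_i = l'_j$.
\<close>

lemma spectral_on_powr_unique:
  assumes P: "spectral_on F P n l u" and P': "spectral_on F P n' l' w"
  shows "(\<Sum>i<n. complex_of_real (l i powr r) * u i m * cnj (u i k))
       = (\<Sum>j<n'. complex_of_real (l' j powr r) * w j m * cnj (w j k))"
proof -
  define c where "c j i = inner_on F (w j) (u i)" for i j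
  \<comment> \<open>Self-adjointness of P: the inner product of w_j with P u_i is evaluated with P
    acting on either side.\<close>
  have lc: "complex_of_real (l' j) * c j i = complex_of_real (l i) * c j i" if "i < n" "j < n'" for i j
  proof -
    have "complex_of_real (l' j) * c j i = inner_on F (w j) (apply_on F P (u i))"
      by (simp add: spectral_on_inner[OF P' that(2)] c_def)
    also have "\<dots> = complex_of_real (l i) * c j i"
    proof -
      have "apply_on F P (u i) = (\<lambda>m. complex_of_real (l i) * u i m)"
        using spectral_on_eigen[OF P that(1)] by blast
      then show ?thesis by (simp add: inner_on_mult_right c_def)
    qed
    finally show ?thesis .
  qed
  then have eq: "c j i = 0 \<or> l' j = l i" if "i < n" "j < n'" for i j
    using that by force
  have lpos: "l i > 0" if "i < n" for i using P that by (simp add: spectral_on_def)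
  have l'pos: "l' i > 0" if "i < n'" for i using P' that by (simp add: spectral_on_def)
  \<comment> \<open>Because l_i > 0, the eigenvector u_i = P u_i / l_i lies in the range of P, hence
    in the span of the w_j.\<close>
  have uexp: "u i m = (\<Sum>j<n'. c j i * w j m)" if "i < n" for i m
  proof -
    have "complex_of_real (l i) * u i m = (\<Sum>j<n'. complex_of_real (l' j) * c j i * w j m)"
      unfolding c_def by (simp add: spectral_on_eigen[OF P that, symmetric] spectral_on_apply[OF P'])
    also have "\<dots> = complex_of_real (l i) * (\<Sum>j<n'. c j i * w j m)"
      unfolding sum_distrib_left using lc[OF that] by (intro sum.cong) auto
    finally show ?thesis using lpos[OF that] by simp
  qed
  have wexp: "w j k = (\<Sum>i<n. cnj (c j i) * u i k)" if "j < n'" for j k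
  proof -
    have "complex_of_real (l' j) * w j k = (\<Sum>i<n. complex_of_real (l i) * cnj (c j i) * u i k)"
      unfolding c_def inner_on_cnj
      by (simp add: spectral_on_eigen[OF P' that, symmetric] spectral_on_apply[OF P])
    also have "\<dots> = complex_of_real (l' j) * (\<Sum>i<n. cnj (c j i) * u i k)"
      unfolding sum_distrib_left
    proof (intro sum.cong refl)
      fix i assume "i \<in> {..<n}"
      then show "complex_of_real (l i) * cnj (c j i) * u i k = complex_of_real (l' j) * (cnj (c j i) * u i k)"
        using eq[of i j] that by auto
    qed
    finally show ?thesis using l'pos[OF that] by simp
  qed
  have "(\<Sum>i<n. complex_of_real (l i powr r) * u i m * cnj (u i k))
      = (\<Sum>i<n. \<Sum>j<n'. complex_of_real (l i powr r) * (c j i * w j m) * cnj (u i k))"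
    using uexp[of _ m] by (intro sum.cong refl) (simp add: sum_distrib_left sum_distrib_right)
  also have "\<dots> = (\<Sum>i<n. \<Sum>j<n'. complex_of_real (l' j powr r) * w j m * (c j i * cnj (u i k)))"
  proof (intro sum.cong refl)
    fix i j assume "i \<in> {..<n}" "j \<in> {..<n'}"
    then show "complex_of_real (l i powr r) * (c j i * w j m) * cnj (u i k)
        = complex_of_real (l' j powr r) * w j m * (c j i * cnj (u i k))"
      using eq[of i j] by auto
  qed
  also have "\<dots> = (\<Sum>j<n'. \<Sum>i<n. complex_of_real (l' j powr r) * w j m * (c j i * cnj (u i k)))"
    by (rule sum.swap)
  also have "\<dots> = (\<Sum>j<n'. complex_of_real (l' j powr r) * w j m * cnj (w j k))"
    using wexp[of _ k] by (intro sum.cong refl) (simp add: sum_distrib_left)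
  finally show ?thesis .
qed

lemma ell2_inner_supported:
  assumes "finite F" "\<And>m. m \<notin> F \<Longrightarrow> x m = 0"
  shows "ell2_inner x y = inner_on F x y"
  unfolding ell2_inner_def inner_on_def
  by (rule infsum_finite_support) (use assms in auto)

text \<open>The definition allows eigenvectors anywhere in l_2. For m outside F the diagonal entry P
  m m, which is the sum of the l_i |u_i(m)|^2, vanishes, and l_i > 0 forces u_i(m) = 0. All
  decompositions therefore live on F, where inner products are finite sums.\<close>

lemma is_mat_powr_iff:
  assumes F: "finite F" and P: "supported_on F P"
  shows "is_mat_powr P r Q \<longleftrightarrow> (\<exists>n l u. spectral_on F P n l u \<and>
           Q = (\<lambda>m k. \<Sum>i<n. complex_of_real (l i powr r) * u i m * cnj (u i k)))"
proof
  assume "is_mat_powr P r Q"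
  then show "\<exists>n l u. spectral_on F P n l u \<and>
           Q = (\<lambda>m k. \<Sum>i<n. complex_of_real (l i powr r) * u i m * cnj (u i k))"
    unfolding is_mat_powr_def
  proof (elim exE conjE)
    fix n :: nat and l :: "nat \<Rightarrow> real" and u :: "nat \<Rightarrow> cvec"
    assume l': "\<forall>i<n. l i > 0 \<and> u i \<in> ell2"
      and u: "\<forall>i<n. \<forall>j<n. ell2_inner (u i) (u j) = (if i = j then 1 else 0)"
      and Peq: "P = (\<lambda>m k. \<Sum>i<n. complex_of_real (l i) * u i m * cnj (u i k))"
      and Q: "Q = (\<lambda>m k. \<Sum>i<n. complex_of_real (l i powr r) * u i m * cnj (u i k))"
    have l: "l i > 0" if "i < n" for i using l' that by blast
    have u0: "u i m = 0" if "i < n" "m \<notin> F" for i m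
    proof -
      have "complex_of_real (\<Sum>i<n. l i * (cmod (u i m))\<^sup>2) = P m m"
        by (simp add: Peq complex_norm_square mult_ac del: of_real_power)
      also have "P m m = 0" using P that(2) by (auto simp: supported_on_def)
      finally have "(\<Sum>i<n. l i * (cmod (u i m))\<^sup>2) = 0" by (simp only: of_real_eq_0_iff)
      moreover have "0 \<le> l j * (cmod (u j m))\<^sup>2" if "j \<in> {..<n}" for j
        using l[of j] that by (simp add: less_imp_le)
      ultimately have "\<forall>j\<in>{..<n}. l j * (cmod (u j m))\<^sup>2 = 0"
        using sum_nonneg_eq_0_iff[of "{..<n}" "\<lambda>j. l j * (cmod (u j m))\<^sup>2", OF finite_lessThan] by blast
      then have "l i * (cmod (u i m))\<^sup>2 = 0" using that(1) by blast
      then show ?thesis using l[OF that(1)] by auto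
    qed
    have "spectral_on F P n l u"
      unfolding spectral_on_def orthonormal_on_def
      using l u0 u Peq ell2_inner_supported[OF F] by metis
    then show "\<exists>n l u. spectral_on F P n l u \<and>
             Q = (\<lambda>m k. \<Sum>i<n. complex_of_real (l i powr r) * u i m * cnj (u i k))"
      using Q by blast
  qed
next
  assume "\<exists>n l u. spectral_on F P n l u \<and>
           Q = (\<lambda>m k. \<Sum>i<n. complex_of_real (l i powr r) * u i m * cnj (u i k))"
  then obtain n l u where s: "spectral_on F P n l u"
    and Q: "Q = (\<lambda>m k. \<Sum>i<n. complex_of_real (l i powr r) * u i m * cnj (u i k))" by blast
  have u0: "u i m = 0" if "i < n" "m \<notin> F" for i m
    using s that by (auto simp: spectral_on_def)
  have "u i \<in> ell2" if "i < n" for i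
  proof -
    have "(\<lambda>m. (cmod (u i m))\<^sup>2) summable_on UNIV \<longleftrightarrow> (\<lambda>m. (cmod (u i m))\<^sup>2) summable_on F"
      by (rule summable_on_cong_neutral) (use u0[OF that] in auto)
    then show ?thesis using F by (simp add: ell2_def)
  qed
  moreover have "ell2_inner (u i) (u j) = (if i = j then 1 else 0)" if "i < n" "j < n" for i j
    using ell2_inner_supported[OF F, of "u i" "u j"] u0[OF that(1)] s that
    by (simp add: spectral_on_def orthonormal_on_def)
  ultimately show "is_mat_powr P r Q"
    unfolding is_mat_powr_def using s Q by (auto simp: spectral_on_def intro!: exI[of _ n] exI[of _ l] exI[of _ u])
qed

text \<open>Resolves the \<open>THE\<close>: the given decomposition supplies a value, and by
  \<open>spectral_on_powr_unique\<close> every other one supplies the same.\<close>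

lemma mat_powr_spectral:
  assumes F: "finite F" and P: "supported_on F P" and s: "spectral_on F P n l u"
  shows "mat_powr P r = (\<lambda>m k. \<Sum>i<n. complex_of_real (l i powr r) * u i m * cnj (u i k))"
  unfolding mat_powr_def
proof (rule the_equality)
  show "is_mat_powr P r (\<lambda>m k. \<Sum>i<n. complex_of_real (l i powr r) * u i m * cnj (u i k))"
    using s by (auto simp: is_mat_powr_iff[OF F P])
  fix Q assume "is_mat_powr P r Q"
  then obtain n' l' w where "spectral_on F P n' l' w"
    and Q: "Q = (\<lambda>m k. \<Sum>i<n'. complex_of_real (l' i powr r) * w i m * cnj (w i k))"
    by (auto simp: is_mat_powr_iff[OF F P])
  then show "Q = (\<lambda>m k. \<Sum>i<n. complex_of_real (l i powr r) * u i m * cnj (u i k))"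
    using spectral_on_powr_unique[OF s] by fastforce
qed

text \<open>Orthonormality removes the v_i from A^* A, which is left with eigenvalues sigma_i^2 and
  eigenvectors u_i. The power p/2 turns these eigenvalues into sigma_i^p, and the trace sums
  them.\<close>

lemma schatten_norm_svd:
  assumes F: "finite F" and A: "supported_on F A"
    and \<sigma>: "\<And>i. i < n \<Longrightarrow> \<sigma> i > 0" and v: "orthonormal_on F n v" and u: "orthonormal_on F n u"
    and u0: "\<And>i m. i < n \<Longrightarrow> m \<notin> F \<Longrightarrow> u i m = 0"
    and Aeq: "A = (\<lambda>m k. \<Sum>i<n. complex_of_real (\<sigma> i) * v i m * cnj (u i k))"
  shows "schatten_norm p A = (\<Sum>i<n. \<sigma> i powr p) powr (1 / p)"
proof -
  have abs: "mat_abs_sq A m k = (\<Sum>i<n. complex_of_real ((\<sigma> i)\<^sup>2) * u i m * cnj (u i k))" for m k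
  proof -
    have "mat_abs_sq A m k = (\<Sum>j\<in>F. \<Sum>i<n. \<Sum>i'<n. complex_of_real (\<sigma> i) * complex_of_real (\<sigma> i')
        * u i m * cnj (u i' k) * (cnj (v i j) * v i' j))"
      unfolding mat_abs_sq_supported[OF F A] by (simp add: Aeq sum_product mult_ac)
    also have "\<dots> = (\<Sum>i<n. \<Sum>i'<n. \<Sum>j\<in>F. complex_of_real (\<sigma> i) * complex_of_real (\<sigma> i')
        * u i m * cnj (u i' k) * (cnj (v i j) * v i' j))"
      by (subst sum.swap) (intro sum.cong refl sum.swap)
    also have "\<dots> = (\<Sum>i<n. \<Sum>i'<n. complex_of_real (\<sigma> i) * complex_of_real (\<sigma> i')
        * u i m * cnj (u i' k) * inner_on F (v i) (v i'))"
      by (simp add: inner_on_def sum_distrib_left)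
    also have "\<dots> = (\<Sum>i<n. \<Sum>i'<n. if i' = i then complex_of_real ((\<sigma> i)\<^sup>2) * u i m * cnj (u i k) else 0)"
      using v by (intro sum.cong refl) (auto simp: orthonormal_on_def power2_eq_square)
    finally show ?thesis by simp
  qed
  have \<sigma>2: "(\<sigma> i)\<^sup>2 > 0" if "i < n" for i
    using \<sigma>[OF that] by simp
  have s: "spectral_on F (mat_abs_sq A) n (\<lambda>i. (\<sigma> i)\<^sup>2) u"
    unfolding spectral_on_def
    by (intro conjI allI impI ext abs u) (use \<sigma>2 u0 in blast)+
  have "((\<sigma> i)\<^sup>2) powr (p / 2) = \<sigma> i powr p" if "i < n" for i
    using \<sigma>[OF that] by (simp add: powr_powr flip: powr_numeral)
  then have Q: "mat_powr (mat_abs_sq A) (p / 2)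
      = (\<lambda>m k. \<Sum>i<n. complex_of_real (\<sigma> i powr p) * u i m * cnj (u i k))"
    by (simp add: mat_powr_spectral[OF F supported_on_mat_abs_sq[OF F A] s])
  have "mat_trace (mat_powr (mat_abs_sq A) (p / 2))
      = (\<Sum>m\<in>F. \<Sum>i<n. complex_of_real (\<sigma> i powr p) * u i m * cnj (u i m))"
    unfolding mat_trace_def Q using F u0 by (intro infsum_finite_support) auto
  also have "\<dots> = (\<Sum>i<n. complex_of_real (\<sigma> i powr p) * inner_on F (u i) (u i))"
    by (subst sum.swap) (simp add: inner_on_def sum_distrib_left mult_ac)
  also have "\<dots> = complex_of_real (\<Sum>i<n. \<sigma> i powr p)"
    using u by (simp add: orthonormal_on_def)
  finally show ?thesis by (simp add: schatten_norm_def)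
qed

section \<open>Interpolation\<close>

text \<open>Hadamard's three lines theorem. Division by M0^(1-z) M1^z normalises both boundary
  bounds to 1. The factor exp(e (z^2 - 1)) has modulus at most 1 on the strip and decays in the
  imaginary direction, so the maximum modulus principle on a rectangle suffices. Finally e tends to
  0.\<close>

lemma three_lines:
  fixes f :: "complex \<Rightarrow> complex"
  assumes hol: "f holomorphic_on {z. 0 < Re z \<and> Re z < 1}"
    and cont: "continuous_on {z. 0 \<le> Re z \<and> Re z \<le> 1} f"
    and bdd: "\<And>z. 0 \<le> Re z \<Longrightarrow> Re z \<le> 1 \<Longrightarrow> cmod (f z) \<le> B"
    and M: "M0 > 0" "M1 > 0"
    and b0: "\<And>z. Re z = 0 \<Longrightarrow> cmod (f z) \<le> M0"
    and b1: "\<And>z. Re z = 1 \<Longrightarrow> cmod (f z) \<le> M1"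
    and \<theta>: "0 \<le> \<theta>" "\<theta> \<le> 1"
  shows "cmod (f (complex_of_real \<theta>)) \<le> M0 powr (1 - \<theta>) * M1 powr \<theta>"
proof -
  define N where "N x = M0 powr (1 - x) * M1 powr x" for x
  have N: "N x > 0" for x using M by (simp add: N_def)
  have le: "cmod (f (complex_of_real \<theta>)) / N \<theta> * exp (e * (\<theta>\<^sup>2 - 1)) \<le> 1" if e: "e > 0" for e
  proof -
    define g where "g z = f z * (exp (- ((1 - z) * complex_of_real (ln M0) + z * complex_of_real (ln M1)))
        * exp (complex_of_real e * (z\<^sup>2 - 1)))" for z
    have eN: "exp ((1 - x) * ln M0 + x * ln M1) = N x" for x
      using M by (simp add: N_def powr_def exp_add)
    have g: "cmod (g z) = cmod (f z) / N (Re z) * exp (e * ((Re z)\<^sup>2 - (Im z)\<^sup>2 - 1))" for z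
    proof -
      have re: "Re (- ((1 - z) * complex_of_real (ln M0) + z * complex_of_real (ln M1)))
          = - ((1 - Re z) * ln M0 + Re z * ln M1)"
        "Re (complex_of_real e * (z\<^sup>2 - 1)) = e * ((Re z)\<^sup>2 - (Im z)\<^sup>2 - 1)"
        by (simp_all add: power2_eq_square)
      have en: "exp (- ((1 - Re z) * ln M0 + Re z * ln M1)) = inverse (N (Re z))"
        by (simp only: exp_minus eN)
      show ?thesis
        unfolding g_def norm_mult norm_exp_eq_Re re en by (simp add: divide_inverse)
    qed
    define D where "D = exp (\<bar>ln M0\<bar> + \<bar>ln M1\<bar>)"
    have D: "1 / N x \<le> D" if "0 \<le> x" "x \<le> 1" for x
    proof -
      have "1 / N x = exp (- ((1 - x) * ln M0 + x * ln M1))"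
        by (simp only: exp_minus eN inverse_eq_divide)
      moreover have *: "- (c * r) \<le> \<bar>r\<bar>" if "0 \<le> c" "c \<le> 1" for c r :: real
        using that mult_right_mono[of c 1 "\<bar>r\<bar>"] abs_ge_minus_self[of "c * r"] by (simp add: abs_mult)
      moreover have "- ((1 - x) * ln M0) \<le> \<bar>ln M0\<bar>" "- (x * ln M1) \<le> \<bar>ln M1\<bar>"
        using that by (intro *; simp)+
      ultimately show ?thesis by (simp add: D_def)
    qed
    have B0: "B \<ge> 0" using order_trans[OF norm_ge_zero bdd[of 0]] by simp
    \<comment> \<open>The height is chosen so that on the horizontal sides |g| <= B D exp(- e R^2) =
      B D exp(- B D) <= 1.\<close>
    define R where "R = sqrt (B * D / e)"
    have R: "R \<ge> 0" "e * R\<^sup>2 = B * D"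
      using e B0 by (auto simp: R_def D_def)
    have "cmod (g (complex_of_real \<theta>)) \<le> 1"
    proof (rule maximum_modulus_frontier[where f = g and S = "cbox (Complex 0 (- R)) (Complex 1 R)"])
      show "g holomorphic_on interior (cbox (Complex 0 (- R)) (Complex 1 R))"
        unfolding g_def interior_cbox
        by (intro holomorphic_intros holomorphic_on_subset[OF hol]) (auto simp: in_box_complex_iff)
      show "continuous_on (closure (cbox (Complex 0 (- R)) (Complex 1 R))) g"
        unfolding g_def closure_cbox
        by (intro continuous_intros continuous_on_subset[OF cont]) (auto simp: in_cbox_complex_iff)
      show "complex_of_real \<theta> \<in> cbox (Complex 0 (- R)) (Complex 1 R)"
        using \<theta> R by (simp add: in_cbox_complex_iff)
      fix z assume "z \<in> frontier (cbox (Complex 0 (- R)) (Complex 1 R))"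
      then have z: "0 \<le> Re z" "Re z \<le> 1" and "Re z = 0 \<or> Re z = 1 \<or> (Im z)\<^sup>2 = R\<^sup>2"
        by (auto simp: frontier_cbox in_cbox_complex_iff in_box_complex_iff power2_eq_iff)
      moreover have x1: "(Re z)\<^sup>2 \<le> 1" using z by (simp add: power_le_one)
      have E: "exp (e * ((Re z)\<^sup>2 - (Im z)\<^sup>2 - 1)) \<le> exp (- (e * (Im z)\<^sup>2))"
        using e x1 by (simp add: algebra_simps)
      have E1: "exp (e * ((Re z)\<^sup>2 - (Im z)\<^sup>2 - 1)) \<le> 1"
        by (rule order_trans[OF E]) (use e in simp)
      have side: "cmod (g z) \<le> 1" if "cmod (f z) \<le> N (Re z)"
      proof -
        have "cmod (f z) / N (Re z) * exp (e * ((Re z)\<^sup>2 - (Im z)\<^sup>2 - 1)) \<le> 1 * 1"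
          using that N[of "Re z"] E1 by (intro mult_mono) auto
        then show ?thesis by (simp add: g)
      qed
      ultimately consider "Re z = 0" | "Re z = 1" | "(Im z)\<^sup>2 = R\<^sup>2" by blast
      then show "cmod (g z) \<le> 1"
      proof cases
        case 1
        then show ?thesis using b0[OF 1] M by (intro side) (simp add: N_def)
      next
        case 2
        then show ?thesis using b1[OF 2] M by (intro side) (simp add: N_def)
      next
        case 3
        have "cmod (g z) = (cmod (f z) * (1 / N (Re z))) * exp (e * ((Re z)\<^sup>2 - (Im z)\<^sup>2 - 1))"
          by (simp add: g)
        also have "\<dots> \<le> (B * D) * exp (- (e * (Im z)\<^sup>2))"
          using B0 N[of "Re z"] by (intro mult_mono E bdd z D) (auto simp: D_def)
        also have "\<dots> \<le> exp (B * D) * exp (- (B * D))"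
        proof -
          have "B * D \<le> exp (B * D)" using exp_ge_add_one_self[of "B * D"] by linarith
          then show ?thesis unfolding 3 R(2) by (intro mult_right_mono) auto
        qed
        also have "\<dots> = 1" by (simp flip: exp_add)
        finally show ?thesis .
      qed
    qed auto
    then show ?thesis by (simp add: g)
  qed
  have "((\<lambda>e. cmod (f (complex_of_real \<theta>)) / N \<theta> * exp (e * (\<theta>\<^sup>2 - 1))) \<longlongrightarrow>
      cmod (f (complex_of_real \<theta>)) / N \<theta> * exp (0 * (\<theta>\<^sup>2 - 1))) (at_right 0)"
    by (intro tendsto_intros)
  then have "cmod (f (complex_of_real \<theta>)) / N \<theta> * exp (0 * (\<theta>\<^sup>2 - 1)) \<le> 1"
    by (rule tendsto_upperbound) (use le in \<open>auto simp: eventually_at_right_less eventually_at_filter\<close>)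
  then show ?thesis using N[of \<theta>] by (simp add: N_def)
qed

section \<open>Endpoint bounds and interpolation of Schur forms\<close>

lemma orthonormal_on_cnj:
  assumes "orthonormal_on F n u"
  shows "orthonormal_on F n (\<lambda>i m. cnj (u i m))"
proof -
  have "inner_on F (\<lambda>m. cnj (u i m)) (\<lambda>m. cnj (u j m)) = cnj (inner_on F (u i) (u j))" for i j
    by (simp add: inner_on_def)
  then show ?thesis using assms by (simp add: orthonormal_on_def)
qed

text \<open>The rank-one matrices v_i(m) u_i(k) are orthonormal for the Hilbert-Schmidt inner
  product, so this is Parseval's identity.\<close>

lemma hs_norm_orthonormal:
  assumes v: "orthonormal_on F n v" and u: "orthonormal_on F n u"
  shows "(\<Sum>m\<in>F. \<Sum>k\<in>F. (cmod (\<Sum>i<n. c i * v i m * u i k))\<^sup>2) = (\<Sum>i<n. (cmod (c i))\<^sup>2)"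
proof -
  have "complex_of_real (\<Sum>m\<in>F. \<Sum>k\<in>F. (cmod (\<Sum>i<n. c i * v i m * u i k))\<^sup>2)
      = (\<Sum>m\<in>F. \<Sum>k\<in>F. \<Sum>i<n. \<Sum>j<n. cnj (c j) * c i * (cnj (v j m) * v i m) * (cnj (u j k) * u i k))"
    by (simp add: complex_norm_square sum_product mult_ac del: of_real_power)
  also have "\<dots> = (\<Sum>i<n. \<Sum>j<n. \<Sum>m\<in>F. \<Sum>k\<in>F. cnj (c j) * c i * (cnj (v j m) * v i m) * (cnj (u j k) * u i k))"
    unfolding sum.swap[of _ F "{..<n}"] ..
  also have "\<dots> = (\<Sum>i<n. \<Sum>j<n. cnj (c j) * c i * inner_on F (v j) (v i) * inner_on F (u j) (u i))"
    by (simp add: inner_on_def sum_distrib_left sum_distrib_right mult_ac)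
  also have "\<dots> = (\<Sum>i<n. \<Sum>j<n. if j = i then cnj (c i) * c i else 0)"
    using u v by (intro sum.cong refl) (auto simp: orthonormal_on_def)
  also have "\<dots> = complex_of_real (\<Sum>i<n. (cmod (c i))\<^sup>2)"
    by (simp add: complex_norm_square mult.commute del: of_real_power)
  finally show ?thesis by (simp only: of_real_eq_iff)
qed

text \<open>The endpoint Re z = 0: a symbol bounded by 1 contracts the Hilbert-Schmidt norm, and
  Cauchy-Schwarz over F x F separates the two matrices.\<close>

lemma schur_form_hs_le:
  assumes \<phi>: "\<And>m k. m \<in> F \<Longrightarrow> k \<in> F \<Longrightarrow> cmod (\<phi> m k) \<le> 1"
    and v: "orthonormal_on F n v" and u: "orthonormal_on F n u"
    and x: "orthonormal_on F n' x" and y: "orthonormal_on F n' y"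
  shows "cmod (\<Sum>m\<in>F. \<Sum>k\<in>F. \<phi> m k * (\<Sum>i<n. c i * v i m * u i k) * (\<Sum>j<n'. d j * x j m * y j k))
    \<le> sqrt (\<Sum>i<n. (cmod (c i))\<^sup>2) * sqrt (\<Sum>j<n'. (cmod (d j))\<^sup>2)"
proof -
  define A where "A m k = (\<Sum>i<n. c i * v i m * u i k)" for m k
  define X where "X m k = (\<Sum>j<n'. d j * x j m * y j k)" for m k
  have "cmod (\<Sum>m\<in>F. \<Sum>k\<in>F. \<phi> m k * A m k * X m k)
      = cmod (\<Sum>q\<in>F \<times> F. (\<phi> (fst q) (snd q) * A (fst q) (snd q)) * X (fst q) (snd q))"
    by (simp add: sum.cartesian_product case_prod_beta)
  also have "\<dots> \<le> vnorm (F \<times> F) (\<lambda>q. \<phi> (fst q) (snd q) * A (fst q) (snd q)) * vnorm (F \<times> F) (\<lambda>q. X (fst q) (snd q))"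
    by (rule cmod_sum_mult_le)
  also have "\<dots> \<le> vnorm (F \<times> F) (\<lambda>q. A (fst q) (snd q)) * vnorm (F \<times> F) (\<lambda>q. X (fst q) (snd q))"
    using \<phi> by (intro mult_right_mono L2_set_mono) (auto simp: norm_mult mult_left_le_one_le)
  also have "vnorm (F \<times> F) (\<lambda>q. A (fst q) (snd q)) = sqrt (\<Sum>i<n. (cmod (c i))\<^sup>2)"
    unfolding A_def hs_norm_orthonormal[OF v u, symmetric] L2_set_def
    by (simp add: sum.cartesian_product case_prod_beta)
  also have "vnorm (F \<times> F) (\<lambda>q. X (fst q) (snd q)) = sqrt (\<Sum>j<n'. (cmod (d j))\<^sup>2)"
    unfolding X_def hs_norm_orthonormal[OF x y, symmetric] L2_set_def
    by (simp add: sum.cartesian_product case_prod_beta)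
  finally show ?thesis by (simp add: A_def X_def)
qed

lemma bilin_sum_rank_one:
  fixes x y :: "'a \<Rightarrow> complex"
  shows "(\<Sum>m\<in>F. \<Sum>k\<in>F. (\<Sum>i\<in>I. c i * v i m * u i k) * y m * x k)
    = (\<Sum>i\<in>I. c i * (\<Sum>m\<in>F. v i m * y m) * (\<Sum>k\<in>F. u i k * x k))"
proof -
  have "(\<Sum>m\<in>F. \<Sum>k\<in>F. (\<Sum>i\<in>I. c i * v i m * u i k) * y m * x k)
      = (\<Sum>m\<in>F. \<Sum>k\<in>F. \<Sum>i\<in>I. c i * (v i m * y m) * (u i k * x k))"
    by (simp add: sum_distrib_left sum_distrib_right mult_ac)
  also have "\<dots> = (\<Sum>i\<in>I. \<Sum>m\<in>F. \<Sum>k\<in>F. c i * (v i m * y m) * (u i k * x k))"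
    unfolding sum.swap[of _ F I] ..
  finally show ?thesis by (simp add: sum_distrib_left sum_distrib_right mult_ac)
qed

text \<open>Cauchy-Schwarz over i, followed by Bessel's inequality for each of the two
  families.\<close>

lemma bilin_bound_orthonormal:
  assumes v: "orthonormal_on F n v" and u: "orthonormal_on F n u"
    and c: "\<And>i. i < n \<Longrightarrow> cmod (c i) \<le> 1"
  shows "bilin_bound F (\<lambda>m k. \<Sum>i<n. c i * v i m * u i k) 1"
  unfolding bilin_bound_def bilin_sum_rank_one
proof (intro allI)
  fix x y :: "'a \<Rightarrow> complex"
  have bessel: "vnorm {..<n} (\<lambda>i. \<Sum>m\<in>F. w i m * z m) \<le> vnorm F z"
    if "orthonormal_on F n w" for w z
    using bessel_inequality[OF orthonormal_on_cnj[OF that], of z]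
    by (simp add: inner_on_def L2_set_def sum_nonneg real_sqrt_le_iff real_le_lsqrt)
  have "cmod (\<Sum>i<n. c i * (\<Sum>m\<in>F. v i m * y m) * (\<Sum>k\<in>F. u i k * x k))
      \<le> vnorm {..<n} (\<lambda>i. c i * (\<Sum>m\<in>F. v i m * y m)) * vnorm {..<n} (\<lambda>i. \<Sum>k\<in>F. u i k * x k)"
    by (rule cmod_sum_mult_le)
  also have "\<dots> \<le> vnorm {..<n} (\<lambda>i. \<Sum>m\<in>F. v i m * y m) * vnorm {..<n} (\<lambda>i. \<Sum>k\<in>F. u i k * x k)"
    using c by (intro mult_right_mono L2_set_mono) (auto simp: norm_mult mult_left_le_one_le)
  also have "\<dots> \<le> vnorm F y * vnorm F x"
    by (intro mult_mono bessel u v) auto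
  finally show "cmod (\<Sum>i<n. c i * (\<Sum>m\<in>F. v i m * y m) * (\<Sum>k\<in>F. u i k * x k)) \<le> 1 * vnorm F y * vnorm F x"
    by simp
qed

text \<open>Duality between operator and trace norm: each rank-one piece of the second matrix tests
  the form of A on unit vectors, which costs at most c.\<close>

lemma bilin_bound_trace_le:
  assumes A: "bilin_bound F A c"
    and x: "orthonormal_on F n x" and y: "orthonormal_on F n y"
  shows "cmod (\<Sum>m\<in>F. \<Sum>k\<in>F. A m k * (\<Sum>j<n. d j * x j m * y j k)) \<le> c * (\<Sum>j<n. cmod (d j))"
proof -
  have "(\<Sum>m\<in>F. \<Sum>k\<in>F. A m k * (\<Sum>j<n. d j * x j m * y j k))
      = (\<Sum>m\<in>F. \<Sum>k\<in>F. \<Sum>j<n. d j * (A m k * x j m * y j k))"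
    by (simp add: sum_distrib_left mult_ac)
  also have "\<dots> = (\<Sum>j<n. d j * (\<Sum>m\<in>F. \<Sum>k\<in>F. A m k * x j m * y j k))"
    unfolding sum.swap[of _ "{..<n}" F] by (simp add: sum_distrib_left)
  finally have "cmod (\<Sum>m\<in>F. \<Sum>k\<in>F. A m k * (\<Sum>j<n. d j * x j m * y j k))
      \<le> (\<Sum>j<n. cmod (d j) * cmod (\<Sum>m\<in>F. \<Sum>k\<in>F. A m k * x j m * y j k))"
    by (simp add: norm_mult[symmetric] norm_sum)
  also have "\<dots> \<le> (\<Sum>j<n. cmod (d j) * c)"
  proof (intro sum_mono mult_left_mono)
    fix j assume "j \<in> {..<n}"
    then have "j < n" by simp
    then show "cmod (\<Sum>m\<in>F. \<Sum>k\<in>F. A m k * x j m * y j k) \<le> c"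
      using A[unfolded bilin_bound_def, rule_format, of "x j" "y j"]
      by (simp add: vnorm_orthonormal[OF x] vnorm_orthonormal[OF y])
  qed auto
  finally show ?thesis by (simp add: sum_distrib_left mult.commute)
qed

text \<open>A bound uniform in Im z, for the boundedness hypothesis of \<open>three_lines\<close>.
  In its uses r comes from a logarithm of either sign, hence the absolute value.\<close>

lemma strip_exp_le:
  assumes "0 \<le> Re z" "Re z \<le> 1"
  shows "cmod (exp (z * complex_of_real r)) \<le> exp \<bar>r\<bar>"
proof -
  have "Re z * r \<le> Re z * \<bar>r\<bar>" "Re z * \<bar>r\<bar> \<le> 1 * \<bar>r\<bar>"
    using assms mult_right_mono[of "Re z" 1 "\<bar>r\<bar>"] mult_left_mono[of r "\<bar>r\<bar>" "Re z"] by auto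
  then show ?thesis by (simp add: norm_exp_eq_Re)
qed

text \<open>
  Stein interpolation along
  $z \mapsto \sum_{m,k} \psi_{mk}\, w_{mk}^{z/2}
    \bigl(\sum_i a_i^{1-z} v_i u_i\bigr)_{mk} \bigl(\sum_j b_j^{1+z} x_j y_j\bigr)_{mk}$:
  Hilbert-Schmidt duality bounds it on $\Re z = 0$, and duality between operator and trace norm,
  with the row bound for Schur multipliers, on $\Re z = 1$.
\<close>

lemma schur_interpolation:
  fixes F :: "int set"
  assumes F: "finite F"
    and v: "orthonormal_on F n v" and u: "orthonormal_on F n u"
    and x: "orthonormal_on F n' x" and y: "orthonormal_on F n' y"
    and a: "\<And>i. i < n \<Longrightarrow> a i > 0" and b: "\<And>j. j < n' \<Longrightarrow> b j > 0"
    and \<psi>: "\<And>m k. cmod (\<psi> m k) \<le> 1" and \<theta>: "0 \<le> \<theta>" "\<theta> \<le> 1"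
  shows "cmod (\<Sum>m\<in>F. \<Sum>k\<in>F. \<psi> m k * complex_of_real (bessel_weight m k powr (\<theta> / 2))
       * (\<Sum>i<n. complex_of_real (a i powr (1 - \<theta>)) * v i m * u i k)
       * (\<Sum>j<n'. complex_of_real (b j powr (1 + \<theta>)) * x j m * y j k))
     \<le> (sqrt (\<Sum>i<n. (a i)\<^sup>2) * sqrt (\<Sum>j<n'. (b j)\<^sup>2)) powr (1 - \<theta>) * (sqrt 5 * (\<Sum>j<n'. (b j)\<^sup>2)) powr \<theta>"
proof (cases "n = 0 \<or> n' = 0")
  \<comment> \<open>\<open>three_lines\<close> asks for positive boundary constants. If one of the
    decompositions is empty they would be 0, but then the form itself is 0.\<close>
  case True
  then show ?thesis by auto
next
  case False
  define S where "S = (\<Sum>i<n. (a i)\<^sup>2)"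
  define T where "T = (\<Sum>j<n'. (b j)\<^sup>2)"
  have pos: "S > 0" "T > 0"
    using False a b unfolding S_def T_def by (intro sum_pos zero_less_power; auto)+
  define \<omega> where "\<omega> m k z = exp (z * complex_of_real (ln (bessel_weight m k) / 2))" for m k z
  define \<alpha> where "\<alpha> i z = exp ((1 - z) * complex_of_real (ln (a i)))" for i z
  \<comment> \<open>The power b^(1+z) is written as b times b^z, which keeps the exponent inside the
    strip, where \<open>strip_exp_le\<close> applies.\<close>
  define \<beta> where "\<beta> j z = complex_of_real (b j) * exp (z * complex_of_real (ln (b j)))" for j z
  define f where "f z = (\<Sum>m\<in>F. \<Sum>k\<in>F. \<psi> m k * \<omega> m k z * (\<Sum>i<n. \<alpha> i z * v i m * u i k)
      * (\<Sum>j<n'. \<beta> j z * x j m * y j k))" for z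
  have hol: "f holomorphic_on X" for X
    unfolding f_def \<omega>_def \<alpha>_def \<beta>_def by (intro holomorphic_intros)
  have \<omega>: "cmod (\<omega> m k z) = bessel_weight m k powr (Re z / 2)" for m k z
    using bessel_weight_pos[of m k] by (simp add: \<omega>_def norm_exp_eq_Re powr_def)
  have \<alpha>: "cmod (\<alpha> i z) = a i powr (1 - Re z)" if "i < n" for i z
    using a[OF that] by (simp add: \<alpha>_def norm_exp_eq_Re powr_def)
  have \<beta>: "cmod (\<beta> j z) = b j * b j powr Re z" if "j < n'" for j z
    using b[OF that] by (simp add: \<beta>_def norm_exp_eq_Re powr_def norm_mult)
  define B where "B = (\<Sum>m\<in>F. \<Sum>k\<in>F. 1 * exp \<bar>ln (bessel_weight m k) / 2\<bar>
      * (\<Sum>i<n. exp \<bar>ln (a i)\<bar> * cmod (v i m) * cmod (u i k))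
      * (\<Sum>j<n'. \<bar>b j\<bar> * exp \<bar>ln (b j)\<bar> * cmod (x j m) * cmod (y j k)))"
  have "cmod (f (complex_of_real \<theta>)) \<le> (sqrt S * sqrt T) powr (1 - \<theta>) * (sqrt 5 * T) powr \<theta>"
  proof (rule three_lines[OF hol holomorphic_on_imp_continuous_on[OF hol], where B = B])
    fix z :: complex assume z: "0 \<le> Re z" "Re z \<le> 1"
    have z': "0 \<le> Re (1 - z)" "Re (1 - z) \<le> 1" using z by auto
    have e\<omega>: "cmod (\<omega> m k z) \<le> exp \<bar>ln (bessel_weight m k) / 2\<bar>" for m k
      unfolding \<omega>_def by (rule strip_exp_le[OF z])
    have e\<alpha>: "cmod (\<alpha> i z) \<le> exp \<bar>ln (a i)\<bar>" for i
      unfolding \<alpha>_def by (rule strip_exp_le[OF z'])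
    have e\<beta>: "cmod (\<beta> j z) \<le> \<bar>b j\<bar> * exp \<bar>ln (b j)\<bar>" for j
      unfolding \<beta>_def norm_mult norm_of_real by (intro mult_left_mono strip_exp_le z) auto
    have S1: "cmod (\<Sum>i<n. \<alpha> i z * v i m * u i k) \<le> (\<Sum>i<n. exp \<bar>ln (a i)\<bar> * cmod (v i m) * cmod (u i k))" for m k
      by (intro sum_norm_le) (simp add: norm_mult mult_right_mono e\<alpha>)
    have S2: "cmod (\<Sum>j<n'. \<beta> j z * x j m * y j k)
        \<le> (\<Sum>j<n'. \<bar>b j\<bar> * exp \<bar>ln (b j)\<bar> * cmod (x j m) * cmod (y j k))" for m k
      by (intro sum_norm_le) (simp add: norm_mult mult_right_mono e\<beta>)
    show "cmod (f z) \<le> B"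
      unfolding f_def B_def
      by (intro sum_norm_le; unfold norm_mult)+
        (intro mult_mono \<psi> e\<omega> S1 S2; auto intro!: sum_nonneg mult_nonneg_nonneg)
  next
    \<comment> \<open>Here |omega| = 1, |alpha_i| = a_i and |beta_j| = b_j: both matrices are
      measured in the Hilbert-Schmidt norm.\<close>
    fix z :: complex assume z: "Re z = 0"
    have "cmod (f z) \<le> sqrt (\<Sum>i<n. (cmod (\<alpha> i z))\<^sup>2) * sqrt (\<Sum>j<n'. (cmod (\<beta> j z))\<^sup>2)"
      unfolding f_def using \<psi> bessel_weight_pos by (intro schur_form_hs_le v u x y) (simp add: norm_mult \<omega> z order.strict_implies_not_eq[OF bessel_weight_pos, symmetric])
    also have "\<dots> = sqrt S * sqrt T"
    proof -
      have "cmod (\<alpha> i z) = a i" if "i < n" for i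
        using a[OF that] by (simp add: \<alpha>[OF that] z)
      moreover have "cmod (\<beta> j z) = b j" if "j < n'" for j
        using b[OF that] by (simp add: \<beta>[OF that] z)
      ultimately show ?thesis by (simp add: S_def T_def)
    qed
    finally show "cmod (f z) \<le> sqrt S * sqrt T" .
  next
    \<comment> \<open>Here |omega| is the weight to the power 1/2, |alpha_i| = 1 and |beta_j| =
      b_j^2: the first matrix is a contraction, the second has trace norm T.\<close>
    fix z :: complex assume z: "Re z = 1"
    have "bilin_bound F (\<lambda>m k. (\<psi> m k * \<omega> m k z) * (\<Sum>i<n. \<alpha> i z * v i m * u i k)) (sqrt 5 * 1)"
    proof (intro bilin_bound_schur_weight bilin_bound_orthonormal u v F)
      show "cmod (\<alpha> i z) \<le> 1" if "i < n" for i
        using a[OF that] by (simp add: \<alpha>[OF that] z)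
      show "cmod (\<psi> m k * \<omega> m k z) \<le> bessel_weight m k powr (1 / 2)" for m k
        using \<psi>[of m k] by (simp add: norm_mult \<omega> z mult_left_le_one_le)
    qed simp
    from bilin_bound_trace_le[OF this x y, of "\<lambda>j. \<beta> j z"]
    have "cmod (f z) \<le> sqrt 5 * (\<Sum>j<n'. cmod (\<beta> j z))"
      by (simp add: f_def mult.assoc)
    also have "(\<Sum>j<n'. cmod (\<beta> j z)) = T"
    proof -
      have "cmod (\<beta> j z) = (b j)\<^sup>2" if "j < n'" for j
        using b[OF that] by (simp add: \<beta>[OF that] z power2_eq_square)
      then show ?thesis by (simp add: T_def)
    qed
    finally show "cmod (f z) \<le> sqrt 5 * T" .
  qed (use pos \<theta> in auto)
  moreover have "f (complex_of_real \<theta>) = (\<Sum>m\<in>F. \<Sum>k\<in>F. \<psi> m k * complex_of_real (bessel_weight m k powr (\<theta> / 2))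
       * (\<Sum>i<n. complex_of_real (a i powr (1 - \<theta>)) * v i m * u i k)
       * (\<Sum>j<n'. complex_of_real (b j powr (1 + \<theta>)) * x j m * y j k))"
  proof -
    have "\<omega> m k (complex_of_real \<theta>) = complex_of_real (bessel_weight m k powr (\<theta> / 2))" for m k
      using bessel_weight_pos[of m k] by (simp add: \<omega>_def powr_def flip: exp_of_real)
    moreover have "\<alpha> i (complex_of_real \<theta>) = complex_of_real (a i powr (1 - \<theta>))" if "i < n" for i
      using a[OF that] by (simp add: \<alpha>_def powr_def flip: exp_of_real)
    moreover have "\<beta> j (complex_of_real \<theta>) = complex_of_real (b j powr (1 + \<theta>))" if "j < n'" for j
      using b[OF that] by (simp add: \<beta>_def powr_add) (simp add: powr_def flip: exp_of_real)
    ultimately show ?thesis by (simp add: f_def)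
  qed
  ultimately show ?thesis by (simp add: S_def T_def)
qed

text \<open>Orthonormality leaves only the terms i = j. Used with c_j = tau_j and d_j = tau_j^(p-1),
  where the second matrix is the S_p norming functional of the first.\<close>

lemma schatten_duality:
  assumes x: "orthonormal_on F n x" and y: "orthonormal_on F n y"
  shows "(\<Sum>m\<in>F. \<Sum>k\<in>F. (\<Sum>i<n. c i * x i m * cnj (y i k)) * (\<Sum>j<n. d j * cnj (x j m) * y j k))
    = (\<Sum>j<n. c j * d j)"
proof -
  have "(\<Sum>m\<in>F. \<Sum>k\<in>F. (\<Sum>i<n. c i * x i m * cnj (y i k)) * (\<Sum>j<n. d j * cnj (x j m) * y j k))
      = (\<Sum>m\<in>F. \<Sum>k\<in>F. \<Sum>i<n. \<Sum>j<n. c i * d j * (cnj (x j m) * x i m) * (cnj (y i k) * y j k))"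
    by (simp add: sum_product mult_ac)
  also have "\<dots> = (\<Sum>i<n. \<Sum>j<n. \<Sum>m\<in>F. \<Sum>k\<in>F. c i * d j * (cnj (x j m) * x i m) * (cnj (y i k) * y j k))"
    unfolding sum.swap[of _ F "{..<n}"] ..
  also have "\<dots> = (\<Sum>i<n. \<Sum>j<n. c i * d j * inner_on F (x j) (x i) * inner_on F (y i) (y j))"
    by (simp add: inner_on_def sum_distrib_left sum_distrib_right mult_ac)
  also have "\<dots> = (\<Sum>i<n. \<Sum>j<n. if j = i then c i * d i else 0)"
    using x y by (intro sum.cong refl) (auto simp: orthonormal_on_def)
  finally show ?thesis by simp
qed

text \<open>Pairing the image of A with its norming matrix X gives T, the p-th power of the norm to
  be bounded. Read as a Schur form in A and X, T is at most sqrt 5^theta S^(1/p) T^(1-1/p) by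
  interpolation, and the last factor cancels when T > 0.\<close>

lemma schatten_estimate:
  assumes p: "p > 1" and A: "A \<in> fin_matrices" and s: "s \<ge> \<bar>1 / 2 - 1 / p\<bar>"
  shows "schatten_norm p (bessel_L s (schroedinger_L t A))
    \<le> sqrt 5 powr (2 * \<bar>1 / 2 - 1 / p\<bar>) * schatten_norm p A"
proof -
  define \<theta> where "\<theta> = 2 * \<bar>1 / 2 - 1 / p\<bar>"
  have \<theta>: "0 \<le> \<theta>" "\<theta> \<le> 1"
    using p by (auto simp: \<theta>_def abs_if field_simps)
  obtain F where F: "finite F" "supported_on F A"
    using A by (rule fin_matrices_supported)
  define B where "B = (\<lambda>m k. schroedinger_symbol s t m k * A m k)"
  have B: "supported_on F B" using F by (auto simp: supported_on_def B_def)
  obtain n \<sigma> v u where \<sigma>: "\<And>i. i < n \<Longrightarrow> \<sigma> i > 0" and v: "orthonormal_on F n v" and u: "orthonormal_on F n u"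
    and u0: "\<And>i m. i < n \<Longrightarrow> m \<notin> F \<Longrightarrow> u i m = 0"
    and Aeq: "A = (\<lambda>m k. \<Sum>i<n. complex_of_real (\<sigma> i) * v i m * cnj (u i k))"
    using svd_exists[OF F] by blast
  obtain n' \<tau> x y where \<tau>: "\<And>j. j < n' \<Longrightarrow> \<tau> j > 0" and x: "orthonormal_on F n' x" and y: "orthonormal_on F n' y"
    and y0: "\<And>j m. j < n' \<Longrightarrow> m \<notin> F \<Longrightarrow> y j m = 0"
    and Beq: "B = (\<lambda>m k. \<Sum>j<n'. complex_of_real (\<tau> j) * x j m * cnj (y j k))"
    using svd_exists[OF F(1) B] by blast
  define S where "S = (\<Sum>i<n. \<sigma> i powr p)"
  define T where "T = (\<Sum>j<n'. \<tau> j powr p)"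
  have nA: "schatten_norm p A = S powr (1 / p)"
    unfolding S_def by (rule schatten_norm_svd[OF F \<sigma> v u u0 Aeq])
  have nB: "schatten_norm p B = T powr (1 / p)"
    unfolding T_def by (rule schatten_norm_svd[OF F(1) B \<tau> x y y0 Beq])
  have ST: "S \<ge> 0" "T \<ge> 0" by (auto simp: S_def T_def intro!: sum_nonneg)
  define X where "X = (\<lambda>m k. \<Sum>j<n'. complex_of_real (\<tau> j powr (p - 1)) * cnj (x j m) * y j k)"
  \<comment> \<open>The quotient of the symbol by the interpolated weight; its modulus is at most 1
    because s >= theta/2 and the weight is at most 1.\<close>
  define \<psi> where "\<psi> m k = schroedinger_symbol s t m k / complex_of_real (bessel_weight m k powr (\<theta> / 2))" for m k
  have \<psi>: "cmod (\<psi> m k) \<le> 1" for m k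
  proof -
    have "bessel_weight m k powr s \<le> bessel_weight m k powr (\<theta> / 2)"
      using s bessel_weight_pos[of m k] bessel_weight_le_1[of m k] by (intro powr_mono') (auto simp: \<theta>_def)
    then show ?thesis
      using bessel_weight_pos[of m k] by (simp add: \<psi>_def norm_divide cmod_schroedinger_symbol)
  qed
  have \<psi>B: "\<psi> m k * complex_of_real (bessel_weight m k powr (\<theta> / 2)) * A m k = B m k" for m k
    using bessel_weight_pos[of m k] by (simp add: \<psi>_def B_def)
  have "(\<Sum>m\<in>F. \<Sum>k\<in>F. B m k * X m k)
      = (\<Sum>j<n'. complex_of_real (\<tau> j) * complex_of_real (\<tau> j powr (p - 1)))"
    unfolding Beq X_def by (rule schatten_duality[OF x y])
  also have "\<dots> = complex_of_real T"
    using \<tau> by (simp add: T_def powr_mult_base less_imp_le flip: of_real_mult)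
  finally have T: "T = cmod (\<Sum>m\<in>F. \<Sum>k\<in>F. \<psi> m k * complex_of_real (bessel_weight m k powr (\<theta> / 2)) * A m k * X m k)"
    using ST by (simp add: \<psi>B)
  \<comment> \<open>The parameters a_i and b_j of \<open>schur_interpolation\<close> will be
    singular values to the power p/2, so that their squares sum to S and T, in an order that depends
    on p.\<close>
  have sq: "(\<Sum>i<n. (\<sigma> i powr (p / 2))\<^sup>2) = S" "(\<Sum>j<n'. (\<tau> j powr (p / 2))\<^sup>2) = T"
    by (simp_all add: S_def T_def power2_eq_square flip: powr_add)
  have \<sigma>p: "\<sigma> i powr (p / 2) > 0" if "i < n" for i using \<sigma>[OF that] by simp
  have \<tau>p: "\<tau> j powr (p / 2) > 0" if "j < n'" for j using \<tau>[OF that] by simp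
  have main: "T \<le> sqrt 5 powr \<theta> * S powr (1 / p) * T powr (1 - 1 / p)"
  proof (cases "p \<ge> 2")
    case True
    then have th: "\<theta> = 1 - 2 / p" using p by (simp add: \<theta>_def abs_if field_simps)
    \<comment> \<open>These exponents place A on the side of a^(1-theta) and X, with singular values
      tau_j^(p-1), on the side of b^(1+theta).\<close>
    have e: "p / 2 * (1 - \<theta>) = 1" "p / 2 * (1 + \<theta>) = p - 1"
      using p by (simp_all add: th field_simps)
    have A': "A m k = (\<Sum>i<n. complex_of_real ((\<sigma> i powr (p / 2)) powr (1 - \<theta>)) * v i m * cnj (u i k))" for m k
      unfolding Aeq powr_powr e using \<sigma> by (intro sum.cong) (auto simp: abs_of_pos)
    have X': "X m k = (\<Sum>j<n'. complex_of_real ((\<tau> j powr (p / 2)) powr (1 + \<theta>)) * cnj (x j m) * y j k)" for m k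
      unfolding X_def powr_powr e ..
    have "T \<le> (sqrt S * sqrt T) powr (1 - \<theta>) * (sqrt 5 * T) powr \<theta>"
      by (subst T, unfold A' X' sq[symmetric], rule schur_interpolation)
        (use F v orthonormal_on_cnj[OF u] orthonormal_on_cnj[OF x] y \<sigma>p \<tau>p \<psi> \<theta> in auto)
    also have "\<dots> = sqrt 5 powr \<theta> * S powr ((1 - \<theta>) / 2) * (T powr ((1 - \<theta>) / 2) * T powr \<theta>)"
      using ST by (simp add: powr_mult powr_powr flip: powr_half_sqrt)
    also have "T powr ((1 - \<theta>) / 2) * T powr \<theta> = T powr (1 - 1 / p)"
      by (simp add: th flip: powr_add)
    also have "(1 - \<theta>) / 2 = 1 / p" by (simp add: th)
    finally show ?thesis .
  next
    case False
    then have th: "\<theta> = 2 / p - 1" using p by (simp add: \<theta>_def abs_if field_simps)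
    \<comment> \<open>The exponents 1 and p-1 have changed places, so A now goes to the side of
      b^(1+theta) and X to that of a^(1-theta).\<close>
    have e: "p / 2 * (1 + \<theta>) = 1" "p / 2 * (1 - \<theta>) = p - 1"
      using p by (simp_all add: th field_simps)
    have A': "A m k = (\<Sum>i<n. complex_of_real ((\<sigma> i powr (p / 2)) powr (1 + \<theta>)) * v i m * cnj (u i k))" for m k
      unfolding Aeq powr_powr e using \<sigma> by (intro sum.cong) (auto simp: abs_of_pos)
    have X': "X m k = (\<Sum>j<n'. complex_of_real ((\<tau> j powr (p / 2)) powr (1 - \<theta>)) * cnj (x j m) * y j k)" for m k
      unfolding X_def powr_powr e ..
    have T': "T = cmod (\<Sum>m\<in>F. \<Sum>k\<in>F. \<psi> m k * complex_of_real (bessel_weight m k powr (\<theta> / 2)) * X m k * A m k)"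
      by (subst T) (simp only: mult_ac)
    have "T \<le> (sqrt T * sqrt S) powr (1 - \<theta>) * (sqrt 5 * S) powr \<theta>"
      by (subst T', unfold A' X' sq[symmetric], rule schur_interpolation)
        (use F v orthonormal_on_cnj[OF u] orthonormal_on_cnj[OF x] y \<sigma>p \<tau>p \<psi> \<theta> in auto)
    also have "\<dots> = sqrt 5 powr \<theta> * (S powr ((1 - \<theta>) / 2) * S powr \<theta>) * T powr ((1 - \<theta>) / 2)"
      using ST by (simp add: powr_mult powr_powr flip: powr_half_sqrt)
    also have "S powr ((1 - \<theta>) / 2) * S powr \<theta> = S powr (1 / p)"
      by (simp add: th flip: powr_add) (simp add: diff_divide_distrib)
    also have "(1 - \<theta>) / 2 = 1 - 1 / p" by (simp add: th diff_divide_distrib)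
    finally show ?thesis .
  qed
  have "T powr (1 / p) \<le> sqrt 5 powr \<theta> * S powr (1 / p)"
  proof (cases "T = 0")
    case False
    then have "T > 0" using ST by simp
    then have "T powr (1 / p) * T powr (1 - 1 / p) \<le> (sqrt 5 powr \<theta> * S powr (1 / p)) * T powr (1 - 1 / p)"
      using main by (simp flip: powr_add)
    then show ?thesis
      by (rule mult_right_le_imp_le) (use \<open>T > 0\<close> in simp)
  qed simp
  then show ?thesis
    unfolding bessel_schroedinger_eq B_def[symmetric] nA nB \<theta>_def .
qed

theorem theorem4p7:
  shows "(\<exists>C>0. \<forall>t::real. \<forall>A\<in>fin_matrices. \<forall>s\<ge>1 / 2.
            bmo_col_norm (bessel_L s (schroedinger_L t A))
              \<le> C * (1 + \<bar>t\<bar>) powr (1 / 2) * op_norm A) \<and>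
         (\<forall>p>1. \<exists>C>0. \<forall>t::real. \<forall>A\<in>fin_matrices. \<forall>s\<ge>\<bar>1 / 2 - 1 / p\<bar>.
            schatten_norm p (bessel_L s (schroedinger_L t A))
              \<le> C * (1 + \<bar>t\<bar>) powr \<bar>1 / 2 - 1 / p\<bar> * schatten_norm p A)"
proof -
  \<comment> \<open>The estimates are uniform in t, and (1 + |t|)^r with r >= 0 is a factor at least
    1 that can be inserted on the right.\<close>
  have weaken: "X \<le> C * (1 + \<bar>t\<bar>) powr r * Y"
    if "X \<le> C * Y" "C \<ge> 0" "Y \<ge> 0" "r \<ge> 0" for X C Y r t :: real
  proof -
    have "C * Y * 1 \<le> C * Y * (1 + \<bar>t\<bar>) powr r"
      using that by (intro mult_left_mono ge_one_powr_ge_zero) auto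
    then show ?thesis using that(1) by (simp add: mult_ac)
  qed
  show ?thesis
  proof (intro conjI allI impI)
    show "\<exists>C>0. \<forall>t. \<forall>A\<in>fin_matrices. \<forall>s\<ge>1 / 2. bmo_col_norm (bessel_L s (schroedinger_L t A))
        \<le> C * (1 + \<bar>t\<bar>) powr (1 / 2) * op_norm A"
      by (intro exI[of _ "2 * sqrt 5"] conjI allI ballI impI weaken bmo_estimate)
        (auto elim!: fin_matrices_supported intro: op_norm_nonneg)
    fix p :: real assume "p > 1"
    then show "\<exists>C>0. \<forall>t. \<forall>A\<in>fin_matrices. \<forall>s\<ge>\<bar>1 / 2 - 1 / p\<bar>.
        schatten_norm p (bessel_L s (schroedinger_L t A))
          \<le> C * (1 + \<bar>t\<bar>) powr \<bar>1 / 2 - 1 / p\<bar> * schatten_norm p A"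
      by (intro exI[of _ "sqrt 5 powr (2 * \<bar>1 / 2 - 1 / p\<bar>)"] conjI allI ballI impI weaken schatten_estimate)
        (auto simp: schatten_norm_def)
  qed
qed

end
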